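(* Let $\Delta$ be a simplicial tree with a good leaf order $F_0,F_1,\ldots,F_q$ on its facets, such that each $F_u$ is a leaf of $\Delta_u=\langle F_0,\ldots,F_u\rangle$ for $u\le q$. Then for all $i\ge1$ and $j\ge0$ $$\beta_{i,j}(\mathcal{F}(\Delta))=\beta_{i,j}(\mathcal{F}(\langle F_0\rangle))+\sum_{u=1}^{q}\beta_{i-1,\,j-|F_u|}\bigl(\mathcal{F}((\Delta_{u-1})_{\overline{F_u}})\bigr).$$
   Context: A simplicial complex $\Delta$ on a finite vertex set is a collection of subsets (faces) containing all singletons and closed under taking subsets; its maximal faces are its facets. $\langle F_1,\ldots,F_r\rangle$ denotes the simplicial complex with facets $F_1,\ldots,F_r$. A subcollection of $\Delta$ is a simplicial complex whose facets are also facets of $\Delta$. $\Delta$ is connected if any two facets are joined by a sequence of facets with consecutive ones intersecting. A facet $F$ of $\Delta$ is a leaf if either $F$ is the only facet of $\Delta$, or there is a facet $G\ne F$ of $\Delta$ (a joint of $F$) with $F\cap H\subseteq G$ for all facets $H\neq F$ of $\Delta$. A simplicial forest is a simplicial complex in which every nonempty subcollection has a leaf; a simplicial tree is a connected simplicial forest. A good leaf of $\Delta$ is a facet that is a leaf of every subcollection of $\Delta$ containing it. A good leaf order on $\Delta$ is an ordering $F_0,\ldots,F_q$ of all its facets such that $F_0$ is a good leaf, $F_0\cap F_1\supseteq\cdots\supseteq F_0\cap F_q$, and $F_i$ is a leaf of $\langle F_0,\ldots,F_i\rangle$ for every $i\le q$. Let $k$ be a field and $R$ the polynomial ring over $k$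 with variables the vertices of $\Delta$. The facet ideal $\mathcal{F}(\Gamma)$ of a simplicial complex $\Gamma$ on a subset of the vertices is the ideal of $R$ generated by the monomials $\prod_{x\in F}x$, $F$ a facet of $\Gamma$. For a simplicial complex $\Gamma$ and a set of vertices $F$, $\Gamma_{\overline{F}}$ is the facet complex of the localization of $\mathcal{F}(\Gamma)$ at the prime ideal generated by the variables not in $F$; concretely, its facets are the inclusion-minimal sets among $\{G\setminus F: G\text{ a facet of }\Gamma\}$. For a graded ideal $I$, $\beta_{i,j}(I)$ is the $\mathbb{N}$-graded Betti number: the number of copies of $R(-j)$ in homological degree $i$ of the minimal graded free resolution $\cdots\to\bigoplus_d R(-d)^{\beta_{0,d}}\to I\to0$ of $I$ (it is $0$ when $j<0$). *)

theory Defs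
  imports "HOL-Library.Poly_Mapping" "Jordan_Normal_Form.Matrix"
begin

section \<open>Simplicial complexes, forests and good leaf orders\<close>

definition simplicial_complex_on :: "'v set \<Rightarrow> 'v set set \<Rightarrow> bool" where
  "simplicial_complex_on V \<Delta> \<longleftrightarrow>
     finite V \<and> (\<forall>F\<in>\<Delta>. F \<subseteq> V) \<and> (\<forall>v\<in>V. {v} \<in> \<Delta>) \<and> (\<forall>F\<in>\<Delta>. \<forall>G. G \<subseteq> F \<longrightarrow> G \<in> \<Delta>)"

definition facets :: "'v set set \<Rightarrow> 'v set set" where
  "facets \<Delta> = {F \<in> \<Delta>. \<forall>G\<in>\<Delta>. F \<subseteq> G \<longrightarrow> G = F}"

text \<open>The complex written with angle brackets: its facets are exactly the members of \<open>A\<close>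
  whenever these are pairwise incomparable.\<close>

definition complex_of :: "'v set set \<Rightarrow> 'v set set" where
  "complex_of A = {G. \<exists>F\<in>A. G \<subseteq> F}"

text \<open>The vertex set of a subcollection is not prescribed: by the singleton axiom it can only be
  the union of its faces.\<close>

definition subcollection :: "'v set set \<Rightarrow> 'v set set \<Rightarrow> bool" where
  "subcollection \<Gamma> \<Delta> \<longleftrightarrow> simplicial_complex_on (\<Union>\<Gamma>) \<Gamma> \<and> facets \<Gamma> \<subseteq> facets \<Delta>"

definition connected_complex :: "'v set set \<Rightarrow> bool" where
  "connected_complex \<Delta> \<longleftrightarrow>
     (\<forall>F\<in>facets \<Delta>. \<forall>G\<in>facets \<Delta>.
        (F, G) \<in> {(A, B). A \<in> facets \<Delta> \<and> B \<in> facets \<Delta> \<and> A \<inter> B \<noteq> {}}\<^sup>*)"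

definition is_leaf :: "'v set set \<Rightarrow> 'v set \<Rightarrow> bool" where
  "is_leaf \<Delta> F \<longleftrightarrow> F \<in> facets \<Delta> \<and>
     (facets \<Delta> = {F} \<or>
      (\<exists>G\<in>facets \<Delta>. G \<noteq> F \<and> (\<forall>H\<in>facets \<Delta>. H \<noteq> F \<longrightarrow> F \<inter> H \<subseteq> G)))"

definition simplicial_forest :: "'v set \<Rightarrow> 'v set set \<Rightarrow> bool" where
  "simplicial_forest V \<Delta> \<longleftrightarrow> simplicial_complex_on V \<Delta> \<and>
     (\<forall>\<Gamma>. subcollection \<Gamma> \<Delta> \<and> \<Gamma> \<noteq> {} \<longrightarrow> (\<exists>F. is_leaf \<Gamma> F))"

definition simplicial_tree :: "'v set \<Rightarrow> 'v set set \<Rightarrow> bool" where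
  "simplicial_tree V \<Delta> \<longleftrightarrow> simplicial_forest V \<Delta> \<and> connected_complex \<Delta>"

definition good_leaf :: "'v set set \<Rightarrow> 'v set \<Rightarrow> bool" where
  "good_leaf \<Delta> F \<longleftrightarrow> F \<in> facets \<Delta> \<and>
     (\<forall>\<Gamma>. subcollection \<Gamma> \<Delta> \<and> F \<in> facets \<Gamma> \<longrightarrow> is_leaf \<Gamma> F)"

text \<open>The order is given by \<open>F 0, \<dots>, F q\<close>; values of \<open>F\<close> beyond \<open>q\<close> are irrelevant.\<close>

definition good_leaf_order :: "'v set set \<Rightarrow> nat \<Rightarrow> (nat \<Rightarrow> 'v set) \<Rightarrow> bool" where
  "good_leaf_order \<Delta> q F \<longleftrightarrow>
     bij_betw F {..q} (facets \<Delta>) \<and>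
     good_leaf \<Delta> (F 0) \<and>
     (\<forall>i. 1 \<le> i \<and> i < q \<longrightarrow> F 0 \<inter> F (Suc i) \<subseteq> F 0 \<inter> F i) \<and>
     (\<forall>i\<le>q. is_leaf (complex_of (F ` {..i})) (F i))"

text \<open>\<open>localization \<Gamma> F\<close> is the facet complex of the localization of the facet ideal of \<open>\<Gamma>\<close> at the
  prime generated by the variables outside \<open>F\<close>: variables in \<open>F\<close> become units, so each generator
  \<open>G\<close> turns into \<open>G - F\<close>, and only the inclusion-minimal ones remain generators.\<close>

definition localization :: "'v set set \<Rightarrow> 'v set \<Rightarrow> 'v set set" where
  "localization \<Gamma> F =
     (let \<G> = {G - F | G. G \<in> facets \<Gamma>}
      in complex_of {A \<in> \<G>. \<forall>B\<in>\<G>. B \<subseteq> A \<longrightarrow> B = A})"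

section \<open>Polynomials and facet ideals\<close>

type_synonym ('v, 'k) mpoly = "('v \<Rightarrow>\<^sub>0 nat) \<Rightarrow>\<^sub>0 'k"

definition var :: "'v \<Rightarrow> ('v, 'k::field) mpoly" where
  "var x = Poly_Mapping.single (Poly_Mapping.single x 1) 1"

definition polys :: "'v set \<Rightarrow> ('v, 'k::field) mpoly set" where
  "polys V = {p. \<forall>m\<in>Poly_Mapping.keys p. Poly_Mapping.keys m \<subseteq> V}"

definition facet_ideal :: "'v set \<Rightarrow> 'v set set \<Rightarrow> ('v, 'k::field) mpoly set" where
  "facet_ideal V \<Gamma> =
     {\<Sum>F\<in>facets \<Gamma>. c F * (\<Prod>x\<in>F. var x) | c. \<forall>F\<in>facets \<Gamma>. c F \<in> polys V}"

section \<open>Minimal graded free resolutions and graded Betti numbers\<close>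

definition total_degree :: "('v \<Rightarrow>\<^sub>0 nat) \<Rightarrow> nat" where
  "total_degree m = (\<Sum>x\<in>Poly_Mapping.keys m. Poly_Mapping.lookup m x)"

text \<open>The graded piece of degree \<open>e\<close> of the polynomial ring on \<open>V\<close>, which is zero for \<open>e < 0\<close>.\<close>

definition homogeneous :: "'v set \<Rightarrow> int \<Rightarrow> ('v, 'k::field) mpoly set" where
  "homogeneous V e = {p \<in> polys V. \<forall>m\<in>Poly_Mapping.keys p. int (total_degree m) = e}"

definition free_module :: "'v set \<Rightarrow> nat \<Rightarrow> ('v, 'k::field) mpoly vec set" where
  "free_module V n = {v \<in> carrier_vec n. \<forall>a<n. v $ a \<in> polys V}"

text \<open>With \<open>R\<close> the polynomial ring on \<open>V\<close>, the data \<open>S\<close>, \<open>g\<close>, \<open>D\<close> encode the complex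
  \<open>\<dots> \<rightarrow> F\<^sub>1 \<rightarrow> F\<^sub>0 \<rightarrow> I \<rightarrow> 0\<close> where \<open>F\<^sub>i\<close> is the direct sum of the \<open>R(-d)\<close>, \<open>d\<close> running through the list
  \<open>S i\<close>; the map from \<open>F\<^sub>i\<^sub>+\<^sub>1\<close> to \<open>F\<^sub>i\<close> is multiplication by the matrix \<open>D i\<close>, and the augmentation
  \<open>F\<^sub>0 \<rightarrow> I\<close> is the product with the row of generators \<open>g\<close>. The maps preserve degrees because an
  entry mapping \<open>R(-e)\<close> to \<open>R(-d)\<close> is homogeneous of degree \<open>e - d\<close>. Minimality says that the
  image of \<open>F\<^sub>i\<^sub>+\<^sub>1\<close> lies in \<open>\<mm>F\<^sub>i\<close>, \<open>\<mm>\<close> being the ideal generated by the variables: no entry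
  has a constant term.\<close>

definition graded_free_resolution ::
  "'v set \<Rightarrow> ('v, 'k::field) mpoly set \<Rightarrow>
   (nat \<Rightarrow> int list) \<Rightarrow> ('v, 'k) mpoly vec \<Rightarrow> (nat \<Rightarrow> ('v, 'k) mpoly mat) \<Rightarrow> bool" where
  "graded_free_resolution V I S g D \<longleftrightarrow>
     g \<in> carrier_vec (length (S 0)) \<and>
     (\<forall>a<length (S 0). g $ a \<in> homogeneous V (S 0 ! a)) \<and>
     (\<forall>i. D i \<in> carrier_mat (length (S i)) (length (S (Suc i)))) \<and>
     (\<forall>i. \<forall>a<length (S i). \<forall>b<length (S (Suc i)).
        D i $$ (a, b) \<in> homogeneous V (S (Suc i) ! b - S i ! a)) \<and>
     (\<lambda>v. g \<bullet> v) ` free_module V (length (S 0)) = I \<and>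
     {v \<in> free_module V (length (S 0)). g \<bullet> v = 0} =
       (\<lambda>w. D 0 *\<^sub>v w) ` free_module V (length (S 1)) \<and>
     (\<forall>i. {v \<in> free_module V (length (S (Suc i))). D i *\<^sub>v v = 0\<^sub>v (length (S i))} =
       (\<lambda>w. D (Suc i) *\<^sub>v w) ` free_module V (length (S (Suc (Suc i)))))"

definition minimal_graded_free_resolution ::
  "'v set \<Rightarrow> ('v, 'k::field) mpoly set \<Rightarrow>
   (nat \<Rightarrow> int list) \<Rightarrow> ('v, 'k) mpoly vec \<Rightarrow> (nat \<Rightarrow> ('v, 'k) mpoly mat) \<Rightarrow> bool" where
  "minimal_graded_free_resolution V I S g D \<longleftrightarrow>
     graded_free_resolution V I S g D \<and>
     (\<forall>i. \<forall>a<length (S i). \<forall>b<length (S (Suc i)).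
        Poly_Mapping.lookup (D i $$ (a, b)) 0 = 0)"

text \<open>The minimal graded free resolution is unique up to isomorphism, so the choice made here does
  not affect the multiplicity of \<open>j\<close> among the shifts in homological degree \<open>i\<close>.\<close>

definition graded_betti :: "'v set \<Rightarrow> ('v, 'k::field) mpoly set \<Rightarrow> nat \<Rightarrow> int \<Rightarrow> nat" where
  "graded_betti V I i j =
     count_list ((SOME S. \<exists>g D. minimal_graded_free_resolution V I S g D) i) j"

end

(*
  A leaf F_u has a vertex x lying on no earlier facet. Write m = x p for its monomial, I for the
  ideal of the earlier facets and J = I : m, which is the facet ideal of the localization. As x does
  not occur in the generators of I, already p J lies in I, so multiplication by m from J to I lifts
  to x times a chain map between the minimal resolutions. Hence the mapping cone of
  J(-|F_u|) -> I + R(-|F_u|), which resolves I + (m), is again minimal, and the Betti numbers add up;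
  summing over u gives the formula. Minimal resolutions exist by the same construction, since
  removing a leaf and localizing both lead from a forest to a smaller forest. The Betti numbers do
  not depend on the resolution because a chain map lifting zero on the ideal is null-homotopic,
  hence has no constant terms.
*)
theory Submission
  imports Defs "Jordan_Normal_Form.Determinant"
begin

section \<open>Polynomials\<close>

text \<open>\<open>graded_betti\<close> reads its value off shifts picked by \<open>SOME\<close>, so
  nothing can be said about it for an ideal until some minimal resolution of that ideal has been
  exhibited. This is why existence has to be proved alongside the recursion, for the ideals of
  forests that occur in it. All resolutions are augmented, so that they resolve R/I and have R
  itself in degree 0. In this form the cone is that of R/J(-|F|) -> R/I, and the extra summand
  R(-|F|) is simply the shifted degree 0 term of the resolution of R/J. Exactness and the lifting of
  chain maps then need only one family of matrices, with no separate row of generators. On the side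
  of the ideals, everything is reduced to supports of monomials: for squarefree generators,
  membership is a condition on each monomial separately, so colon ideals and the inclusion p J in I
  become inclusions between finite sets.\<close>

lemma polys_zero [simp]: "0 \<in> polys V"
  and polys_one [simp]: "1 \<in> polys V"
  by (auto simp: polys_def)

lemma polys_add: "p \<in> polys V \<Longrightarrow> q \<in> polys V \<Longrightarrow> p + q \<in> polys V"
  using Poly_Mapping.keys_add[of p q] by (auto simp: polys_def)

lemma polys_uminus: "p \<in> polys V \<Longrightarrow> - p \<in> polys V"
  by (simp add: polys_def Poly_Mapping.keys_def)

lemma polys_mult:
  assumes "p \<in> polys V" "q \<in> polys V"
  shows "p * q \<in> polys V"
  unfolding polys_def
proof (intro CollectI ballI)
  fix m assume "m \<in> Poly_Mapping.keys (p * q)"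
  then obtain a b where "m = a + b" "a \<in> Poly_Mapping.keys p" "b \<in> Poly_Mapping.keys q"
    using Poly_Mapping.keys_mult[of p q] by blast
  then show "Poly_Mapping.keys m \<subseteq> V"
    using assms Poly_Mapping.keys_add[of a b] by (fastforce simp: polys_def)
qed

lemma polys_sum: "(\<And>x. x \<in> A \<Longrightarrow> f x \<in> polys V) \<Longrightarrow> sum f A \<in> polys V"
  by (induction A rule: infinite_finite_induct) (auto intro: polys_add)

lemma keys_add_nat: "Poly_Mapping.keys (a + b) = Poly_Mapping.keys a \<union> Poly_Mapping.keys b"
  for a b :: "'v \<Rightarrow>\<^sub>0 nat"
  by (auto simp: in_keys_iff lookup_add)

lemma total_degree_superset:
  assumes "finite A" "Poly_Mapping.keys m \<subseteq> A"
  shows "total_degree m = (\<Sum>x\<in>A. Poly_Mapping.lookup m x)"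
  unfolding total_degree_def
  using assms by (intro sum.mono_neutral_left) (auto simp: in_keys_iff)

lemma total_degree_add: "total_degree (a + b) = total_degree a + total_degree b"
proof -
  let ?A = "Poly_Mapping.keys a \<union> Poly_Mapping.keys b"
  show ?thesis
    by (simp add: total_degree_superset[of ?A] keys_add_nat lookup_add sum.distrib)
qed

lemma total_degree_zero [simp]: "total_degree 0 = 0"
  by (simp add: total_degree_def)

lemma homogeneous_imp_polys: "p \<in> homogeneous V e \<Longrightarrow> p \<in> polys V"
  by (simp add: homogeneous_def)

lemma homogeneous_zero [simp]: "0 \<in> homogeneous V e"
  by (simp add: homogeneous_def)

lemma homogeneous_one [simp]: "1 \<in> homogeneous V 0"
  by (simp add: homogeneous_def)

lemma homogeneous_add:
  "p \<in> homogeneous V e \<Longrightarrow> q \<in> homogeneous V e \<Longrightarrow> p + q \<in> homogeneous V e"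
  using Poly_Mapping.keys_add[of p q] by (auto simp: homogeneous_def intro: polys_add)

lemma homogeneous_uminus: "p \<in> homogeneous V e \<Longrightarrow> - p \<in> homogeneous V e"
  by (auto simp: homogeneous_def Poly_Mapping.keys_def polys_def)

lemma homogeneous_diff:
  "p \<in> homogeneous V e \<Longrightarrow> q \<in> homogeneous V e \<Longrightarrow> p - q \<in> homogeneous V e"
  using homogeneous_add[of p V e "- q"] homogeneous_uminus by fastforce

lemma homogeneous_sum: "(\<And>x. x \<in> A \<Longrightarrow> f x \<in> homogeneous V e) \<Longrightarrow> sum f A \<in> homogeneous V e"
  by (induction A rule: infinite_finite_induct) (auto intro: homogeneous_add)

lemma homogeneous_mult:
  assumes p: "p \<in> homogeneous V d" and q: "q \<in> homogeneous V e"
  shows "p * q \<in> homogeneous V (d + e)"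
  unfolding homogeneous_def
proof (intro CollectI conjI ballI)
  show "p * q \<in> polys V"
    using p q by (simp add: homogeneous_def polys_mult)
  fix m assume "m \<in> Poly_Mapping.keys (p * q)"
  then obtain a b where "m = a + b" "a \<in> Poly_Mapping.keys p" "b \<in> Poly_Mapping.keys q"
    using Poly_Mapping.keys_mult[of p q] by blast
  then show "int (total_degree m) = d + e"
    using p q by (auto simp: homogeneous_def total_degree_add)
qed

lemma homogeneous_mult':
  "p \<in> homogeneous V d \<Longrightarrow> q \<in> homogeneous V e \<Longrightarrow> d + e = f \<Longrightarrow> p * q \<in> homogeneous V f"
  using homogeneous_mult by blast

section \<open>Homogeneous components and constant terms\<close>

definition hpart :: "int \<Rightarrow> ('v, 'k::field) mpoly \<Rightarrow> ('v, 'k) mpoly" where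
  "hpart e p = (\<Sum>m | m \<in> Poly_Mapping.keys p \<and> int (total_degree m) = e.
     Poly_Mapping.single m (Poly_Mapping.lookup p m))"

lemma lookup_hpart:
  "Poly_Mapping.lookup (hpart e p) m =
     (if int (total_degree m) = e then Poly_Mapping.lookup p m else 0)"
proof -
  have "Poly_Mapping.lookup (hpart e p) m = (\<Sum>n | n \<in> Poly_Mapping.keys p \<and> int (total_degree n) = e.
      if n = m then Poly_Mapping.lookup p m else 0)"
    unfolding hpart_def lookup_sum by (intro sum.cong) (auto simp: lookup_single when_def)
  also have "\<dots> = (if int (total_degree m) = e then Poly_Mapping.lookup p m else 0)"
    by (subst sum.delta) (auto simp: in_keys_iff)
  finally show ?thesis .
qed

lemma keys_hpart:
  "Poly_Mapping.keys (hpart e p) = {m \<in> Poly_Mapping.keys p. int (total_degree m) = e}"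
  by (auto simp: in_keys_iff lookup_hpart split: if_splits)

lemma hpart_homogeneous: "p \<in> polys V \<Longrightarrow> hpart e p \<in> homogeneous V e"
  by (auto simp: homogeneous_def polys_def keys_hpart)

lemma hpart_id: "p \<in> homogeneous V e \<Longrightarrow> hpart e p = p"
  by (rule poly_mapping_eqI) (auto simp: lookup_hpart homogeneous_def in_keys_iff)

lemma hpart_sum: "hpart e (sum f A) = (\<Sum>x\<in>A. hpart e (f x))"
  by (rule poly_mapping_eqI) (auto simp: lookup_hpart lookup_sum)

lemma hpart_add: "hpart e (p + q) = hpart e p + hpart e q"
  by (rule poly_mapping_eqI) (auto simp: lookup_hpart lookup_add)

text \<open>A monomial of the product is a sum of an exponent of degree \<open>d\<close> and an
  exponent of \<open>q\<close>. It has degree \<open>e\<close> only if the latter has degree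
  \<open>e - d\<close>, so the remainder \<open>?r\<close> contributes nothing in degree
  \<open>e\<close>.\<close>

lemma hpart_mult:
  assumes p: "p \<in> homogeneous V d" and q: "q \<in> polys V"
  shows "hpart e (p * q) = p * hpart (e - d) q"
proof -
  let ?r = "q - hpart (e - d) q"
  have h: "p * hpart (e - d) q \<in> homogeneous V e"
    using homogeneous_mult[OF p hpart_homogeneous[OF q, of "e - d"]] by simp
  have "Poly_Mapping.lookup (p * ?r) m = 0" if "int (total_degree m) = e" for m
  proof (rule ccontr)
    assume "Poly_Mapping.lookup (p * ?r) m \<noteq> 0"
    then have "m \<in> Poly_Mapping.keys (p * ?r)"
      by (simp add: in_keys_iff)
    then obtain a b where ab: "m = a + b" "a \<in> Poly_Mapping.keys p" "b \<in> Poly_Mapping.keys ?r"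
      using Poly_Mapping.keys_mult[of p ?r] by blast
    then have "int (total_degree b) = e - d"
      using that p by (auto simp: homogeneous_def total_degree_add)
    then show False
      using ab(3) by (simp add: in_keys_iff lookup_minus lookup_hpart)
  qed
  then have "hpart e (p * ?r) = 0"
    by (intro poly_mapping_eqI) (auto simp: lookup_hpart)
  moreover have "p * q = p * hpart (e - d) q + p * ?r"
    by (simp add: algebra_simps)
  ultimately have "hpart e (p * q) = hpart e (p * hpart (e - d) q)"
    by (metis add.right_neutral hpart_add)
  then show ?thesis
    using hpart_id[OF h] by simp
qed

text \<open>Exponents are natural numbers, so a sum of two of them vanishes only if both do:
  splitting off the constant terms leaves factors whose products never reach exponent 0.\<close>

lemma lookup_mult_zero:
  fixes p q :: "('v, 'k::field) mpoly"
  shows "Poly_Mapping.lookup (p * q) 0 = Poly_Mapping.lookup p 0 * Poly_Mapping.lookup q 0"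
proof -
  have zero: "a = 0 \<and> b = 0" if "0 = a + b" for a b :: "'v \<Rightarrow>\<^sub>0 nat"
    using that keys_add_nat[of a b] by (metis Un_empty keys_eq_empty)
  define p' where "p' = p - Poly_Mapping.single 0 (Poly_Mapping.lookup p 0)"
  define q' where "q' = q - Poly_Mapping.single 0 (Poly_Mapping.lookup q 0)"
  have pk: "0 \<notin> Poly_Mapping.keys p'" and qk: "0 \<notin> Poly_Mapping.keys q'"
    by (auto simp: p'_def q'_def in_keys_iff lookup_minus)
  have "0 \<notin> Poly_Mapping.keys (p' * q)" for q :: "('v, 'k) mpoly"
    using Poly_Mapping.keys_mult[of p' q] pk by (blast dest: zero)
  then have p'0: "Poly_Mapping.lookup (p' * q) 0 = 0" for q :: "('v, 'k) mpoly"
    by (simp add: in_keys_iff)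
  have "0 \<notin> Poly_Mapping.keys (p * q')" for p :: "('v, 'k) mpoly"
    using Poly_Mapping.keys_mult[of p q'] qk by (blast dest: zero)
  then have q'0: "Poly_Mapping.lookup (p * q') 0 = 0" for p :: "('v, 'k) mpoly"
    by (simp add: in_keys_iff)
  define a b where "a = Poly_Mapping.single (0 :: 'v \<Rightarrow>\<^sub>0 nat) (Poly_Mapping.lookup p 0)"
    and "b = Poly_Mapping.single (0 :: 'v \<Rightarrow>\<^sub>0 nat) (Poly_Mapping.lookup q 0)"
  have "p = p' + a" "q = q' + b"
    by (simp_all add: p'_def q'_def a_def b_def)
  then have "p * q = p' * q + a * q' + a * b"
    by (metis distrib_left distrib_right add.assoc)
  then show ?thesis
    by (simp add: lookup_add p'0 q'0) (simp add: a_def b_def mult_single)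
qed

text \<open>Reduction modulo the ideal of the variables. As a ring homomorphism it carries matrix
  products over to the field, so minimality becomes the vanishing of
  \<open>map_mat const_term\<close>.\<close>

definition const_term :: "('v, 'k::field) mpoly \<Rightarrow> 'k" where
  "const_term p = Poly_Mapping.lookup p 0"

interpretation const_hom: comm_ring_hom const_term
  by unfold_locales (simp_all add: const_term_def lookup_add lookup_mult_zero)

lemma const_homogeneous: "p \<in> homogeneous V e \<Longrightarrow> const_term p \<noteq> 0 \<Longrightarrow> e = 0"
  by (force simp: homogeneous_def const_term_def in_keys_iff)

section \<open>Graded matrices\<close>

text \<open>Matrices of degree-preserving maps from the sum of the \<open>R(-e)\<close>, \<open>e\<close> in \<open>U\<close>, to the sum of
  the \<open>R(-d)\<close>, \<open>d\<close> in \<open>T\<close>.\<close>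

definition gmat :: "'v set \<Rightarrow> int list \<Rightarrow> int list \<Rightarrow> ('v, 'k::field) mpoly mat set" where
  "gmat V T U = {M \<in> carrier_mat (length T) (length U).
     \<forall>a<length T. \<forall>b<length U. M $$ (a, b) \<in> homogeneous V (U ! b - T ! a)}"

text \<open>The type \<open>mpoly\<close> admits every variable of type \<open>'v\<close>;
  restricting the source to \<open>free_module V\<close> keeps all images and kernels over the
  polynomial ring on \<open>V\<close>.\<close>

definition image_module :: "'v set \<Rightarrow> ('v, 'k::field) mpoly mat \<Rightarrow> ('v, 'k) mpoly vec set" where
  "image_module V M = (\<lambda>w. M *\<^sub>v w) ` free_module V (dim_col M)"

definition kernel_module :: "'v set \<Rightarrow> ('v, 'k::field) mpoly mat \<Rightarrow> ('v, 'k) mpoly vec set" where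
  "kernel_module V M = {v \<in> free_module V (dim_col M). M *\<^sub>v v = 0\<^sub>v (dim_row M)}"

lemma gmatI:
  "M \<in> carrier_mat (length T) (length U) \<Longrightarrow>
   (\<And>a b. a < length T \<Longrightarrow> b < length U \<Longrightarrow> M $$ (a, b) \<in> homogeneous V (U ! b - T ! a)) \<Longrightarrow>
   M \<in> gmat V T U"
  by (simp add: gmat_def)

lemma gmat_carrier: "M \<in> gmat V T U \<Longrightarrow> M \<in> carrier_mat (length T) (length U)"
  by (simp add: gmat_def)

lemma gmat_entry:
  "M \<in> gmat V T U \<Longrightarrow> a < length T \<Longrightarrow> b < length U \<Longrightarrow>
   M $$ (a, b) \<in> homogeneous V (U ! b - T ! a)"
  by (simp add: gmat_def)

lemma gmat_one: "1\<^sub>m (length T) \<in> gmat V T T"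
  by (rule gmatI) auto

lemma gmat_zero: "0\<^sub>m (length T) (length U) \<in> gmat V T U"
  by (rule gmatI) auto

lemma gmat_mult:
  assumes M: "M \<in> gmat V T U" and N: "N \<in> gmat V U W"
  shows "M * N \<in> gmat V T W"
proof (rule gmatI)
  have c: "M \<in> carrier_mat (length T) (length U)" "N \<in> carrier_mat (length U) (length W)"
    using M N by (auto dest: gmat_carrier)
  then show "M * N \<in> carrier_mat (length T) (length W)"
    by simp
  fix a b assume ab: "a < length T" "b < length W"
  have "(M * N) $$ (a, b) = (\<Sum>i<length U. M $$ (a, i) * N $$ (i, b))"
    using c ab by (auto simp: scalar_prod_def atLeast0LessThan intro!: sum.cong)
  also have "\<dots> \<in> homogeneous V (W ! b - T ! a)"
    using M N ab by (intro homogeneous_sum homogeneous_mult') (auto intro: gmat_entry)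
  finally show "(M * N) $$ (a, b) \<in> homogeneous V (W ! b - T ! a)" .
qed

lemma gmat_minus: "M \<in> gmat V T U \<Longrightarrow> N \<in> gmat V T U \<Longrightarrow> M - N \<in> gmat V T U"
  by (auto simp: gmat_def intro!: homogeneous_diff minus_carrier_mat)

lemma gmat_uminus: "M \<in> gmat V T U \<Longrightarrow> - M \<in> gmat V T U"
  by (auto simp: gmat_def intro!: homogeneous_uminus)

text \<open>The degree condition involves only differences of shifts.\<close>

lemma gmat_shift: "M \<in> gmat V T U \<Longrightarrow> M \<in> gmat V (map ((+) d) T) (map ((+) d) U)"
  by (auto simp: gmat_def)

lemma gmat_smult:
  assumes "M \<in> gmat V T (map ((+) d) U)" "x \<in> homogeneous V e"
  shows "x \<cdot>\<^sub>m M \<in> gmat V T (map ((+) (e + d)) U)"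
proof (rule gmatI)
  show "x \<cdot>\<^sub>m M \<in> carrier_mat (length T) (length (map ((+) (e + d)) U))"
    using gmat_carrier[OF assms(1)] by simp
  fix a b assume ab: "a < length T" "b < length (map ((+) (e + d)) U)"
  then have "x * M $$ (a, b) \<in> homogeneous V (map ((+) (e + d)) U ! b - T ! a)"
    by (intro homogeneous_mult'[OF assms(2) gmat_entry[OF assms(1)]]) auto
  then show "(x \<cdot>\<^sub>m M) $$ (a, b) \<in> homogeneous V (map ((+) (e + d)) U ! b - T ! a)"
    using gmat_carrier[OF assms(1)] ab by simp
qed

lemma free_module_carrier: "v \<in> free_module V n \<Longrightarrow> v \<in> carrier_vec n"
  by (simp add: free_module_def)

lemma free_module_add: "v \<in> free_module V n \<Longrightarrow> w \<in> free_module V n \<Longrightarrow> v + w \<in> free_module V n"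
  by (auto simp: free_module_def polys_add)

lemma free_module_uminus: "v \<in> free_module V n \<Longrightarrow> - v \<in> free_module V n"
  by (auto simp: free_module_def polys_uminus)

lemma free_module_unit: "b < n \<Longrightarrow> unit_vec n b \<in> free_module V n"
  by (auto simp: free_module_def)

lemma gmat_mult_vec:
  assumes M: "M \<in> gmat V T U" and v: "v \<in> free_module V (length U)"
  shows "M *\<^sub>v v \<in> free_module V (length T)"
proof -
  have "(M *\<^sub>v v) $ a \<in> polys V" if a: "a < length T" for a
  proof -
    have "(M *\<^sub>v v) $ a = (\<Sum>i<length U. M $$ (a, i) * v $ i)"
      using gmat_carrier[OF M] free_module_carrier[OF v] a
      by (auto simp: scalar_prod_def atLeast0LessThan intro!: sum.cong)
    also have "\<dots> \<in> polys V"
      using v a gmat_entry[OF M a]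
      by (intro polys_sum polys_mult) (auto simp: free_module_def intro: homogeneous_imp_polys)
    finally show ?thesis .
  qed
  then show ?thesis
    using mult_mat_vec_carrier[OF gmat_carrier[OF M] free_module_carrier[OF v]]
    unfolding free_module_def by blast
qed

lemma mult_unit_vec:
  fixes M :: "'a::semiring_1 mat"
  assumes "M \<in> carrier_mat n m" "b < m"
  shows "M *\<^sub>v unit_vec m b = col M b"
  using assms by (intro eq_vecI) auto

lemma col_in_image:
  assumes "M \<in> carrier_mat n m" "b < m"
  shows "col M b \<in> image_module V M"
proof -
  have "M *\<^sub>v unit_vec m b = col M b"
    using assms by (rule mult_unit_vec)
  then show ?thesis
    using assms free_module_unit[of b m V] unfolding image_module_def by force
qed

text \<open>Taking homogeneous components of the entries turns an arbitrary preimage of a homogeneous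
  vector into a homogeneous one, so columnwise solvability already yields a graded solution.\<close>

lemma lift_gmat:
  assumes M: "M \<in> gmat V T U" and N: "N \<in> gmat V T W"
    and im: "\<And>b. b < length W \<Longrightarrow> col N b \<in> image_module V M"
  shows "\<exists>P\<in>gmat V U W. M * P = N"
proof -
  have Mc: "M \<in> carrier_mat (length T) (length U)" and Nc: "N \<in> carrier_mat (length T) (length W)"
    using M N by (auto dest: gmat_carrier)
  have "\<forall>b. \<exists>w. b < length W \<longrightarrow> w \<in> free_module V (length U) \<and> M *\<^sub>v w = col N b"
    using im Mc unfolding image_module_def by fastforce
  then obtain w where w: "\<And>b. b < length W \<Longrightarrow> w b \<in> free_module V (length U)"
    and Mw: "\<And>b. b < length W \<Longrightarrow> M *\<^sub>v w b = col N b"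
    by metis
  define P where "P = mat (length U) (length W) (\<lambda>(i, b). hpart (W ! b - U ! i) (w b $ i))"
  have Pc: "P \<in> carrier_mat (length U) (length W)"
    by (simp add: P_def)
  have P: "P \<in> gmat V U W"
    using w by (intro gmatI[OF Pc]) (auto simp: P_def free_module_def intro!: hpart_homogeneous)
  have "M * P = N"
  proof (rule eq_matI)
    fix a b assume "a < dim_row N" "b < dim_col N"
    then have ab: "a < length T" "b < length W"
      using Nc by auto
    have "(M * P) $$ (a, b) = (\<Sum>i<length U. M $$ (a, i) * P $$ (i, b))"
      using Mc Pc ab by (auto simp: scalar_prod_def atLeast0LessThan intro!: sum.cong)
    also have "\<dots> = (\<Sum>i<length U. hpart (W ! b - T ! a) (M $$ (a, i) * w b $ i))"
    proof (rule sum.cong)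
      fix i assume "i \<in> {..<length U}"
      then have i: "i < length U" by simp
      then have "w b $ i \<in> polys V"
        using w[OF ab(2)] by (simp add: free_module_def)
      then show "M $$ (a, i) * P $$ (i, b) = hpart (W ! b - T ! a) (M $$ (a, i) * w b $ i)"
        using hpart_mult[OF gmat_entry[OF M ab(1) i], of "w b $ i" "W ! b - T ! a"] i ab
        by (simp add: P_def)
    qed simp
    also have "\<dots> = hpart (W ! b - T ! a) ((M *\<^sub>v w b) $ a)"
      unfolding hpart_sum[symmetric]
      using Mc free_module_carrier[OF w[OF ab(2)]] ab
      by (auto simp: scalar_prod_def atLeast0LessThan intro!: sum.cong arg_cong[of _ _ "hpart _"])
    also have "\<dots> = N $$ (a, b)"
      using Mw[OF ab(2)] hpart_id[OF gmat_entry[OF N ab]] Nc ab by simp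
    finally show "(M * P) $$ (a, b) = N $$ (a, b)" .
  qed (use Mc Nc Pc in auto)
  with P show ?thesis by blast
qed

text \<open>Projectivity of graded free modules: the columns of \<open>N\<close> are cycles,
  exactness makes them boundaries, and \<open>lift_gmat\<close> assembles homogeneous
  preimages.\<close>

lemma lift_gmat_kernel:
  assumes M: "M \<in> gmat V S T" and M': "M' \<in> gmat V T U" and N: "N \<in> gmat V T W"
    and ex: "kernel_module V M \<subseteq> image_module V M'"
    and z: "M * N = 0\<^sub>m (length S) (length W)"
  shows "\<exists>P\<in>gmat V U W. M' * P = N"
proof (rule lift_gmat[OF M' N])
  fix b assume b: "b < length W"
  have c: "M \<in> carrier_mat (length S) (length T)" "N \<in> carrier_mat (length T) (length W)"
    using M N by (auto dest: gmat_carrier)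
  have u: "N *\<^sub>v unit_vec (length W) b = col N b"
    using c b by (intro mult_unit_vec)
  then have "col N b \<in> free_module V (length T)"
    using gmat_mult_vec[OF N free_module_unit[OF b]] by simp
  moreover have "M *\<^sub>v col N b = (M * N) *\<^sub>v unit_vec (length W) b"
    using c by (simp add: u)
  then have "M *\<^sub>v col N b = 0\<^sub>v (length S)"
    unfolding z using b by (auto intro: eq_vecI)
  ultimately show "col N b \<in> image_module V M'"
    using ex c unfolding kernel_module_def by auto
qed

section \<open>Chain maps and homotopies\<close>

text \<open>The comparison theorem. The source only has to be a complex of free modules, the target
  has to be exact; \<open>im\<close> says that the first square can be filled, and exactness fills
  the later ones.\<close>

lemma chain_map_lift:
  fixes E E' :: "nat \<Rightarrow> ('v, 'k::field) mpoly mat"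
  assumes E: "\<And>i. E i \<in> gmat V (T i) (T (Suc i))"
    and E': "\<And>i. E' i \<in> gmat V (U i) (U (Suc i))"
    and EE: "\<And>i. E i * E (Suc i) = 0\<^sub>m (length (T i)) (length (T (Suc (Suc i))))"
    and ex: "\<And>i. kernel_module V (E' i) \<subseteq> image_module V (E' (Suc i))"
    and f0: "f0 \<in> gmat V (U 0) (T 0)"
    and im: "\<And>b. b < length (T 1) \<Longrightarrow> col (f0 * E 0) b \<in> image_module V (E' 0)"
  shows "\<exists>f. f 0 = f0 \<and> (\<forall>i. f i \<in> gmat V (U i) (T i)) \<and> (\<forall>i. E' i * f (Suc i) = f i * E i)"
proof -
  \<comment> \<open>The predicate includes the existence of a filler for the next square, because
    the choice proceeds one index at a time. Any filler \<open>h\<close> can be continued: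
    \<open>E' n * h * E (Suc n)\<close> equals \<open>g * E n * E (Suc n)\<close>, which is
    zero.\<close>
  let ?P = "\<lambda>n f. f \<in> gmat V (U n) (T n) \<and> (n = 0 \<longrightarrow> f = f0) \<and>
      (\<exists>f'\<in>gmat V (U (Suc n)) (T (Suc n)). E' n * f' = f * E n)"
  have "\<exists>f. \<forall>n. ?P n (f n) \<and> E' n * f (Suc n) = f n * E n"
  proof (rule dependent_nat_choice)
    show "\<exists>f. ?P 0 f"
      using f0 lift_gmat[OF E'[of 0] gmat_mult[OF f0 E]] im by auto
    fix g n assume g: "?P n g"
    then obtain h where h: "h \<in> gmat V (U (Suc n)) (T (Suc n))" and eq: "E' n * h = g * E n"
      by blast
    have c: "E n \<in> carrier_mat (length (T n)) (length (T (Suc n)))"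
      "E (Suc n) \<in> carrier_mat (length (T (Suc n))) (length (T (Suc (Suc n))))"
      "E' n \<in> carrier_mat (length (U n)) (length (U (Suc n)))"
      "g \<in> carrier_mat (length (U n)) (length (T n))"
      "h \<in> carrier_mat (length (U (Suc n))) (length (T (Suc n)))"
      using E[of n] E[of "Suc n"] E' g h by (auto dest: gmat_carrier)
    have "E' n * (h * E (Suc n)) = (E' n * h) * E (Suc n)"
      using c by simp
    also have "\<dots> = g * (E n * E (Suc n))"
      unfolding eq using c by simp
    also have "\<dots> = 0\<^sub>m (length (U n)) (length (T (Suc (Suc n))))"
      unfolding EE using c by simp
    finally have "\<exists>h'\<in>gmat V (U (Suc (Suc n))) (T (Suc (Suc n))). E' (Suc n) * h' = h * E (Suc n)"
      by (rule lift_gmat_kernel[OF E' E' gmat_mult[OF h E] ex])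
    with h eq show "\<exists>f. ?P (Suc n) f \<and> E' n * f = g * E n"
      by auto
  qed
  then show ?thesis by blast
qed

text \<open>A homotopy writes \<open>e i\<close> as a sum of two products, each containing a
  differential. Minimal differentials have no constant terms, hence neither do the products. Since
  \<open>e 0\<close> is zero the homotopy may start with zero, so \<open>E 0\<close>, on which no
  minimality is imposed, contributes nothing.\<close>

lemma null_chain_map_const:
  fixes E e :: "nat \<Rightarrow> ('v, 'k::field) mpoly mat"
  assumes E: "\<And>i. E i \<in> gmat V (T i) (T (Suc i))"
    and EE: "\<And>i. E i * E (Suc i) = 0\<^sub>m (length (T i)) (length (T (Suc (Suc i))))"
    and ex: "\<And>i. kernel_module V (E i) \<subseteq> image_module V (E (Suc i))"
    and minimal: "\<And>i. map_mat const_term (E (Suc i)) = 0\<^sub>m (length (T (Suc i))) (length (T (Suc (Suc i))))"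
    and e: "\<And>i. e i \<in> gmat V (T i) (T i)"
    and e0: "e 0 = 0\<^sub>m (length (T 0)) (length (T 0))"
    and comm: "\<And>i. E i * e (Suc i) = e i * E i"
  shows "map_mat const_term (e i) = 0\<^sub>m (length (T i)) (length (T i))"
proof -
  \<comment> \<open>The first clause is the homotopy identity composed with \<open>E i\<close>. It
    avoids mentioning the preceding homotopy component and is exactly what makes
    \<open>e (Suc i) - s * E i\<close> a matrix of cycles, from which the next component is
    lifted.\<close>
  have "\<exists>s\<in>gmat V (T (Suc i)) (T i).
      (e i - E i * s) * E i = 0\<^sub>m (length (T i)) (length (T (Suc i))) \<and>
      map_mat const_term (s * E i) = 0\<^sub>m (length (T (Suc i))) (length (T (Suc i))) \<and>
      map_mat const_term (e i) = 0\<^sub>m (length (T i)) (length (T i))"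
  proof (induction i)
    case 0
    let ?s = "0\<^sub>m (length (T (Suc 0))) (length (T 0)) :: ('v, 'k) mpoly mat"
    have c: "E 0 \<in> carrier_mat (length (T 0)) (length (T (Suc 0)))"
      using E[of 0] by (rule gmat_carrier)
    have z: "0\<^sub>m n m - 0\<^sub>m n m = (0\<^sub>m n m :: ('v, 'k) mpoly mat)" for n m
      by (intro eq_matI) auto
    have cz: "map_mat const_term (0\<^sub>m n m :: ('v, 'k) mpoly mat) = 0\<^sub>m n m" for n m
      by (intro eq_matI) auto
    have "E 0 * ?s = 0\<^sub>m (length (T 0)) (length (T 0))"
      using c by simp
    moreover have "?s * E 0 = 0\<^sub>m (length (T (Suc 0))) (length (T (Suc 0)))"
      using c by simp
    moreover have "0\<^sub>m (length (T 0)) (length (T 0)) * E 0 = 0\<^sub>m (length (T 0)) (length (T (Suc 0)))"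
      using c by simp
    ultimately show ?case
      by (intro bexI[of _ ?s] conjI) (simp_all add: e0 cz z gmat_zero)
  next
    case (Suc i)
    then obtain s where s: "s \<in> gmat V (T (Suc i)) (T i)"
      and s1: "(e i - E i * s) * E i = 0\<^sub>m (length (T i)) (length (T (Suc i)))"
      and s2: "map_mat const_term (s * E i) = 0\<^sub>m (length (T (Suc i))) (length (T (Suc i)))"
      by blast
    let ?N = "e (Suc i) - s * E i"
    have c: "E i \<in> carrier_mat (length (T i)) (length (T (Suc i)))"
      "E (Suc i) \<in> carrier_mat (length (T (Suc i))) (length (T (Suc (Suc i))))"
      "e i \<in> carrier_mat (length (T i)) (length (T i))"
      "e (Suc i) \<in> carrier_mat (length (T (Suc i))) (length (T (Suc i)))"
      "s \<in> carrier_mat (length (T (Suc i))) (length (T i))"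
      using E[of i] E[of "Suc i"] e[of i] e[of "Suc i"] s by (auto dest: gmat_carrier)
    have c': "s * E i \<in> carrier_mat (length (T (Suc i))) (length (T (Suc i)))"
      "E i * s \<in> carrier_mat (length (T i)) (length (T i))"
      using c by auto
    have "E i * ?N = E i * e (Suc i) - E i * (s * E i)"
      using c c' by (intro mult_minus_distrib_mat)
    also have "\<dots> = e i * E i - (E i * s) * E i"
      using c by (simp add: comm)
    also have "\<dots> = (e i - E i * s) * E i"
      using c c' by (intro minus_mult_distrib_mat[symmetric])
    finally have "E i * ?N = 0\<^sub>m (length (T i)) (length (T (Suc i)))"
      using s1 by simp
    then obtain P where P: "P \<in> gmat V (T (Suc (Suc i))) (T (Suc i))" and EP: "E (Suc i) * P = ?N"
      using lift_gmat_kernel[OF E E gmat_minus[OF e gmat_mult[OF s E]] ex] by blast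
    have cP: "P \<in> carrier_mat (length (T (Suc (Suc i)))) (length (T (Suc i)))"
      using P by (rule gmat_carrier)
    have "e (Suc i) - ?N = s * E i"
      using c c' by (intro eq_matI) auto
    then have "(e (Suc i) - E (Suc i) * P) * E (Suc i) = s * (E i * E (Suc i))"
      unfolding EP using c by simp
    also have "\<dots> = 0\<^sub>m (length (T (Suc i))) (length (T (Suc (Suc i))))"
      unfolding EE using c by simp
    finally have 1: "(e (Suc i) - E (Suc i) * P) * E (Suc i) =
      0\<^sub>m (length (T (Suc i))) (length (T (Suc (Suc i))))" .
    have 2: "map_mat const_term (P * E (Suc i)) =
      0\<^sub>m (length (T (Suc (Suc i)))) (length (T (Suc (Suc i))))"
      using const_hom.mat_hom_mult[OF cP c(2)] cP by (simp add: minimal)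
    have EPc: "map_mat const_term (E (Suc i) * P) = 0\<^sub>m (length (T (Suc i))) (length (T (Suc i)))"
      using const_hom.mat_hom_mult[OF c(2) cP] cP by (simp add: minimal)
    have 3: "map_mat const_term (e (Suc i)) = 0\<^sub>m (length (T (Suc i))) (length (T (Suc i)))"
    proof (rule eq_matI)
      fix a b assume "a < dim_row (0\<^sub>m (length (T (Suc i))) (length (T (Suc i))) :: 'k mat)"
        "b < dim_col (0\<^sub>m (length (T (Suc i))) (length (T (Suc i))) :: 'k mat)"
      then have ab: "a < length (T (Suc i))" "b < length (T (Suc i))" by auto
      have "const_term ((s * E i) $$ (a, b)) = map_mat const_term (s * E i) $$ (a, b)"
        using ab c by (subst index_map_mat) auto
      then have "const_term ((s * E i) $$ (a, b)) = 0"
        unfolding s2 using ab by simp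
      moreover have "const_term (?N $$ (a, b)) = map_mat const_term (E (Suc i) * P) $$ (a, b)"
        unfolding EP using ab c by (subst index_map_mat) auto
      then have "const_term (?N $$ (a, b)) = 0"
        unfolding EPc using ab by simp
      moreover have "e (Suc i) $$ (a, b) = (s * E i) $$ (a, b) + ?N $$ (a, b)"
        using ab c by (subst index_minus_mat(1)) (auto simp del: index_mult_mat(1))
      ultimately have "const_term (e (Suc i) $$ (a, b)) = 0"
        by (metis const_hom.hom_add add.right_neutral)
      then show "map_mat const_term (e (Suc i)) $$ (a, b) =
          0\<^sub>m (length (T (Suc i))) (length (T (Suc i))) $$ (a, b)"
        using ab c by simp
    qed (use c in auto)
    from P 1 2 3 show ?case by blast
  qed
  then show ?thesis by blast
qed

section \<open>Uniqueness of graded Betti numbers\<close>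

text \<open>A rank comparison, phrased with index sets instead of dimensions because it is applied
  to the positions of one fixed shift, which form an arbitrary subset of an index range.\<close>

lemma card_le_of_left_inverse:
  fixes A :: "'y \<Rightarrow> 'x \<Rightarrow> 'k::field"
  assumes fin: "finite X" "finite Y"
    and inv: "\<And>x x'. x \<in> X \<Longrightarrow> x' \<in> X \<Longrightarrow> (\<Sum>y\<in>Y. B x y * A y x') = (if x = x' then 1 else 0)"
  shows "card X \<le> card Y"
proof (rule ccontr)
  assume "\<not> card X \<le> card Y"
  then have lt: "card Y < card X" by simp
  let ?n = "card X"
  obtain f where f: "bij_betw f {0..<?n} X"
    using ex_bij_betw_nat_finite[OF fin(1)] by blast
  obtain g where g: "bij_betw g {0..<card Y} Y"
    using ex_bij_betw_nat_finite[OF fin(2)] by blast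
  \<comment> \<open>Padding with zeros to square matrices makes the first one singular.\<close>
  define MB where "MB = mat ?n ?n (\<lambda>(i, k). if k < card Y then B (f i) (g k) else 0)"
  define MA where "MA = mat ?n ?n (\<lambda>(k, i). if k < card Y then A (g k) (f i) else 0)"
  have MB: "MB \<in> carrier_mat ?n ?n" and MA: "MA \<in> carrier_mat ?n ?n"
    by (auto simp: MB_def MA_def)
  have "MB * MA = 1\<^sub>m ?n"
  proof (rule eq_matI)
    fix i j assume "i < dim_row (1\<^sub>m ?n :: 'k mat)" "j < dim_col (1\<^sub>m ?n :: 'k mat)"
    then have ij: "i < ?n" "j < ?n" by auto
    have "(MB * MA) $$ (i, j) = (\<Sum>k\<in>{0..<?n}. MB $$ (i, k) * MA $$ (k, j))"
      using ij MB MA by (auto simp: scalar_prod_def intro!: sum.cong)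
    also have "\<dots> = (\<Sum>k\<in>{0..<card Y}. B (f i) (g k) * A (g k) (f j))"
      using ij lt by (intro sum.mono_neutral_cong_right) (auto simp: MB_def MA_def)
    also have "\<dots> = (\<Sum>y\<in>Y. B (f i) y * A y (f j))"
      by (rule sum.reindex_bij_betw[OF g])
    also have "\<dots> = (if f i = f j then 1 else 0)"
      using f ij by (intro inv) (auto simp: bij_betw_def)
    also have "\<dots> = 1\<^sub>m ?n $$ (i, j)"
      using f ij by (auto simp: bij_betw_def inj_on_def)
    finally show "(MB * MA) $$ (i, j) = 1\<^sub>m ?n $$ (i, j)" .
  qed (use MB MA in auto)
  then have "det MB * det MA = 1"
    using det_mult[OF MB MA] by simp
  moreover have "det MB = 0"
  proof -
    \<comment> \<open>The last column lies in the padding, since \<open>card Y\<close> is at most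
      \<open>?n - 1\<close>; the corresponding unit vector is therefore in the kernel.\<close>
    have n: "?n - 1 < ?n" using lt by simp
    have "MB *\<^sub>v unit_vec ?n (?n - 1) = col MB (?n - 1)"
      using MB n by (rule mult_unit_vec)
    also have "\<dots> = 0\<^sub>v ?n"
      using lt by (intro eq_vecI) (auto simp: MB_def)
    finally show ?thesis
      unfolding det_0_iff_vec_prod_zero_field[OF MB]
      using n by (intro exI[of _ "unit_vec ?n (?n - 1)"]) auto
  qed
  ultimately show False by simp
qed

lemma count_list_card: "count_list xs j = card {a. a < length xs \<and> xs ! a = j}"
  by (simp add: count_list_eq_length_filter length_filter_conv_card eq_commute)

text \<open>By \<open>deg\<close>, the entries of \<open>A\<close> in a column of shift
  \<open>j\<close> vanish outside the rows of shift \<open>j\<close>. Hence the identity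
  \<open>B * A = 1\<close> restricts to the block of shift \<open>j\<close>, where ranks can be
  compared.\<close>

lemma count_list_le:
  fixes A B :: "'k::field mat"
  assumes A: "A \<in> carrier_mat (length U) (length T)" and B: "B \<in> carrier_mat (length T) (length U)"
    and inv: "B * A = 1\<^sub>m (length T)"
    and deg: "\<And>a b. a < length U \<Longrightarrow> b < length T \<Longrightarrow> A $$ (a, b) \<noteq> 0 \<Longrightarrow> U ! a = T ! b"
  shows "count_list T j \<le> count_list U j"
  unfolding count_list_card
proof (rule card_le_of_left_inverse[where A = "\<lambda>y x. A $$ (y, x)" and B = "\<lambda>x y. B $$ (x, y)"])
  fix x x' assume "x \<in> {a. a < length T \<and> T ! a = j}" "x' \<in> {a. a < length T \<and> T ! a = j}"
  then have x: "x < length T" "T ! x = j" "x' < length T" "T ! x' = j" by auto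
  have "(\<Sum>y | y < length U \<and> U ! y = j. B $$ (x, y) * A $$ (y, x')) =
      (\<Sum>y\<in>{0..<length U}. B $$ (x, y) * A $$ (y, x'))"
    using deg x by (intro sum.mono_neutral_left) auto
  also have "\<dots> = (B * A) $$ (x, x')"
    using x A B by (auto simp: scalar_prod_def intro!: sum.cong)
  also have "\<dots> = (if x = x' then 1 else 0)"
    unfolding inv using x by simp
  finally show "(\<Sum>y | y < length U \<and> U ! y = j. B $$ (x, y) * A $$ (y, x')) =
      (if x = x' then 1 else 0)" .
qed auto

section \<open>Augmented resolutions and their comparison\<close>

text \<open>A resolution of \<open>I\<close> prolonged by the augmentation: \<open>T 0\<close> is the shift of the ring itself
  and \<open>E 0\<close> the row of generators, so that the whole is a resolution of \<open>R/I\<close>.\<close>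

definition resolves ::
  "'v set \<Rightarrow> ('v, 'k::field) mpoly set \<Rightarrow> (nat \<Rightarrow> int list) \<Rightarrow> (nat \<Rightarrow> ('v, 'k) mpoly mat) \<Rightarrow> bool" where
  "resolves V I T E \<longleftrightarrow> T 0 = [0] \<and> (\<forall>i. E i \<in> gmat V (T i) (T (Suc i))) \<and>
     (\<lambda>w. (E 0 *\<^sub>v w) $ 0) ` free_module V (length (T 1)) = I \<and>
     (\<forall>i. kernel_module V (E i) = image_module V (E (Suc i)))"

text \<open>Minimality starts at \<open>E 1\<close>: the entries of \<open>E 0\<close> are the
  generators of the ideal, on which minimality of a resolution of \<open>I\<close> puts no
  condition. For the unit ideal they do contain a constant.\<close>

definition minimally_resolves ::
  "'v set \<Rightarrow> ('v, 'k::field) mpoly set \<Rightarrow> (nat \<Rightarrow> int list) \<Rightarrow> (nat \<Rightarrow> ('v, 'k) mpoly mat) \<Rightarrow> bool" where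
  "minimally_resolves V I T E \<longleftrightarrow> resolves V I T E \<and>
     (\<forall>i. map_mat const_term (E (Suc i)) = 0\<^sub>m (length (T (Suc i))) (length (T (Suc (Suc i)))))"

lemma resolves_gmat: "resolves V I T E \<Longrightarrow> E i \<in> gmat V (T i) (T (Suc i))"
  and resolves_T0: "resolves V I T E \<Longrightarrow> T 0 = [0]"
  and resolves_exact: "resolves V I T E \<Longrightarrow> kernel_module V (E i) = image_module V (E (Suc i))"
  by (simp_all add: resolves_def)

lemma resolves_carrier:
  "resolves V I T E \<Longrightarrow> E i \<in> carrier_mat (length (T i)) (length (T (Suc i)))"
  by (intro gmat_carrier resolves_gmat)

text \<open>Ring elements are vectors of length 1 in degree 0; this is where hypotheses on ideals
  enter the matrix arguments.\<close>

lemma resolves_mem_iff: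
  assumes r: "resolves V I T E" and v: "v \<in> carrier_vec 1"
  shows "v \<in> image_module V (E 0) \<longleftrightarrow> v $ 0 \<in> I"
proof -
  have E: "E 0 \<in> carrier_mat 1 (length (T 1))"
    using resolves_carrier[OF r, of 0] resolves_T0[OF r] by simp
  have "v = E 0 *\<^sub>v w \<longleftrightarrow> v $ 0 = (E 0 *\<^sub>v w) $ 0" for w
    using v E by (auto intro!: eq_vecI)
  moreover have "I = (\<lambda>w. (E 0 *\<^sub>v w) $ 0) ` free_module V (length (T 1))"
    using r by (simp add: resolves_def)
  ultimately show ?thesis
    using E by (auto simp: image_module_def)
qed

lemma resolves_complex:
  assumes r: "resolves V I T E"
  shows "E i * E (Suc i) = 0\<^sub>m (length (T i)) (length (T (Suc (Suc i))))"
proof (rule eq_matI)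
  fix a b assume "a < dim_row (0\<^sub>m (length (T i)) (length (T (Suc (Suc i)))) :: ('a, 'b) mpoly mat)"
    "b < dim_col (0\<^sub>m (length (T i)) (length (T (Suc (Suc i)))) :: ('a, 'b) mpoly mat)"
  then have ab: "a < length (T i)" "b < length (T (Suc (Suc i)))" by auto
  have c: "E i \<in> carrier_mat (length (T i)) (length (T (Suc i)))"
    "E (Suc i) \<in> carrier_mat (length (T (Suc i))) (length (T (Suc (Suc i))))"
    using resolves_carrier[OF r] by auto
  have "col (E (Suc i)) b \<in> kernel_module V (E i)"
    unfolding resolves_exact[OF r] using c(2) ab(2) by (rule col_in_image)
  then have "E i *\<^sub>v col (E (Suc i)) b = 0\<^sub>v (length (T i))"
    using c by (simp add: kernel_module_def)
  then have "(E i *\<^sub>v col (E (Suc i)) b) $ a = 0"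
    using ab by simp
  then show "(E i * E (Suc i)) $$ (a, b) = 0\<^sub>m (length (T i)) (length (T (Suc (Suc i)))) $$ (a, b)"
    using ab c by simp
qed (use resolves_carrier[OF r] in auto)

text \<open>Multiplication by \<open>p\<close> is a map from R/I(-d) to R/I' as soon as it sends
  \<open>I\<close> into \<open>I'\<close>. That inclusion is precisely the solvability of the first
  square over the 1 by 1 matrix with entry \<open>p\<close>.\<close>

lemma resolves_lift:
  assumes r: "resolves V I T E" and r': "resolves V I' U E'"
    and p: "p \<in> homogeneous V d" and sub: "\<And>q. q \<in> I \<Longrightarrow> p * q \<in> I'"
  shows "\<exists>f. f 0 = p \<cdot>\<^sub>m 1\<^sub>m 1 \<and> (\<forall>i. f i \<in> gmat V (U i) (map ((+) d) (T i))) \<and>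
     (\<forall>i. E' i * f (Suc i) = f i * E i)"
proof -
  have T0: "T 0 = [0]" and U0: "U 0 = [0]"
    using r r' by (auto dest: resolves_T0)
  have f0: "p \<cdot>\<^sub>m 1\<^sub>m 1 \<in> gmat V (U 0) (map ((+) d) (T 0))"
    using p by (intro gmatI) (auto simp: T0 U0)
  have E0: "E 0 \<in> carrier_mat 1 (length (T 1))"
    using resolves_carrier[OF r, of 0] T0 by simp
  have "\<exists>f. f 0 = p \<cdot>\<^sub>m 1\<^sub>m 1 \<and> (\<forall>i. f i \<in> gmat V (U i) ((\<lambda>i. map ((+) d) (T i)) i)) \<and>
     (\<forall>i. E' i * f (Suc i) = f i * E i)"
  proof (rule chain_map_lift)
    show "E i \<in> gmat V (map ((+) d) (T i)) (map ((+) d) (T (Suc i)))" for i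
      by (intro gmat_shift resolves_gmat[OF r])
    show "E i * E (Suc i) = 0\<^sub>m (length (map ((+) d) (T i))) (length (map ((+) d) (T (Suc (Suc i)))))" for i
      using resolves_complex[OF r] by simp
    show "kernel_module V (E' i) \<subseteq> image_module V (E' (Suc i))" for i
      using resolves_exact[OF r'] by simp
    fix b assume "b < length (map ((+) d) (T 1))"
    then have b: "b < length (T 1)" by simp
    have "col (E 0) b \<in> carrier_vec 1" "col (p \<cdot>\<^sub>m 1\<^sub>m 1 * E 0) b \<in> carrier_vec 1"
      by (simp_all only: carrier_vec_def dim_col index_mult_mat index_smult_mat index_one_mat
          carrier_matD(1)[OF E0] mem_Collect_eq)
    note mem = resolves_mem_iff[OF r this(1)] resolves_mem_iff[OF r' this(2)]
    have "col (E 0) b $ 0 \<in> I"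
      using mem(1) col_in_image[OF E0 b] by blast
    then have "col (p \<cdot>\<^sub>m 1\<^sub>m 1 * E 0) b $ 0 \<in> I'"
      using sub[of "col (E 0) b $ 0"] E0 b by (simp add: scalar_prod_def row_def)
    then show "col (p \<cdot>\<^sub>m 1\<^sub>m 1 * E 0) b \<in> image_module V (E' 0)"
      using mem(2) by blast
  qed (use resolves_gmat[OF r'] f0 in auto)
  then show ?thesis by simp
qed

text \<open>With \<open>f\<close> and \<open>h\<close> lifting the identity of R/I in both
  directions, \<open>h i * f i - 1\<close> lifts zero. So the reductions of \<open>h i\<close> and
  \<open>f i\<close> to the field compose to the identity; this one-sided inverse gives the
  inequality, and exchanging the resolutions gives equality.\<close>

lemma minimally_resolves_count_le:
  assumes "minimally_resolves V I T E" and "minimally_resolves V I U E'"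
  shows "count_list (T i) j \<le> count_list (U i) j"
proof -
  have r: "resolves V I T E" and r': "resolves V I U E'"
    and min: "\<And>i. map_mat const_term (E (Suc i)) = 0\<^sub>m (length (T (Suc i))) (length (T (Suc (Suc i))))"
    using assms by (auto simp: minimally_resolves_def)
  have T0: "T 0 = [0]" and U0: "U 0 = [0]"
    using r r' by (auto dest: resolves_T0)
  have one: "1 \<cdot>\<^sub>m 1\<^sub>m 1 = (1\<^sub>m 1 :: ('a, 'b) mpoly mat)"
    by (intro eq_matI) auto
  have shift0: "(+) (0 :: int) = (\<lambda>x. x)"
    by auto
  obtain f where f0: "f 0 = 1\<^sub>m 1" and f: "\<And>i. f i \<in> gmat V (U i) (T i)"
    and fE: "\<And>i. E' i * f (Suc i) = f i * E i"
    using resolves_lift[OF r r' homogeneous_one] unfolding one shift0 by auto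
  obtain h where h0: "h 0 = 1\<^sub>m 1" and h: "\<And>i. h i \<in> gmat V (T i) (U i)"
    and hE: "\<And>i. E i * h (Suc i) = h i * E' i"
    using resolves_lift[OF r' r homogeneous_one] unfolding one shift0 by auto
  define e where "e i = h i * f i - 1\<^sub>m (length (T i))" for i
  have c: "E i \<in> carrier_mat (length (T i)) (length (T (Suc i)))"
    "E' i \<in> carrier_mat (length (U i)) (length (U (Suc i)))"
    "f i \<in> carrier_mat (length (U i)) (length (T i))"
    "h i \<in> carrier_mat (length (T i)) (length (U i))" for i
    using resolves_carrier[OF r] resolves_carrier[OF r'] f[of i] h[of i] by (auto dest: gmat_carrier)
  have chf: "h i * f i \<in> carrier_mat (length (T i)) (length (T i))" for i
    using c[of i] by simp
  have "E i * e (Suc i) = e i * E i" for i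
  proof -
    have "E i * e (Suc i) = E i * (h (Suc i) * f (Suc i)) - E i"
      unfolding e_def using mult_minus_distrib_mat[OF c(1) chf one_carrier_mat, of i] c(1)[of i] by simp
    also have "E i * (h (Suc i) * f (Suc i)) = (E i * h (Suc i)) * f (Suc i)"
      using c(1)[of i] c(3,4)[of "Suc i"] by simp
    also have "\<dots> = h i * (E' i * f (Suc i))"
      unfolding hE using c(2,4)[of i] c(3)[of "Suc i"] by simp
    also have "\<dots> = (h i * f i) * E i"
      unfolding fE using c[of i] by simp
    also have "(h i * f i) * E i - E i = e i * E i"
      unfolding e_def using minus_mult_distrib_mat[OF chf one_carrier_mat c(1), of i] c(1)[of i] by simp
    finally show ?thesis .
  qed
  then have "map_mat const_term (e i) = 0\<^sub>m (length (T i)) (length (T i))"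
    by (intro null_chain_map_const[where E = E, OF resolves_gmat[OF r] resolves_complex[OF r] _ min])
      (use resolves_exact[OF r] gmat_minus[OF gmat_mult[OF h f] gmat_one] T0 f0 h0
        in \<open>auto simp: e_def intro!: eq_matI\<close>)
  moreover have "map_mat const_term (e i) = map_mat const_term (h i * f i) - 1\<^sub>m (length (T i))"
    unfolding e_def using c[of i] by (intro eq_matI) (auto simp: const_hom.hom_minus)
  ultimately have "map_mat const_term (h i * f i) - 1\<^sub>m (length (T i)) = 0\<^sub>m (length (T i)) (length (T i))"
    by simp
  then have "map_mat const_term (h i * f i) = 1\<^sub>m (length (T i))"
    using chf[of i] by (auto simp: mat_eq_iff)
  then have inv: "map_mat const_term (h i) * map_mat const_term (f i) = 1\<^sub>m (length (T i))"
    using const_hom.mat_hom_mult[OF c(4) c(3), of i] by simp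
  show ?thesis
  proof (rule count_list_le[OF _ _ inv])
    fix a b assume ab: "a < length (U i)" "b < length (T i)" and "map_mat const_term (f i) $$ (a, b) \<noteq> 0"
    then have "const_term (f i $$ (a, b)) \<noteq> 0"
      using c(3)[of i] by simp
    then show "U i ! a = T i ! b"
      using const_homogeneous[OF gmat_entry[OF f[of i] ab]] by simp
  qed (use c[of i] in auto)
qed

text \<open>Prepending the ring raises homological degrees by one: \<open>S i\<close> becomes the
  term of index \<open>Suc i\<close>.\<close>

lemma minimal_graded_free_resolution_resolves:
  assumes "minimal_graded_free_resolution V I S g D"
  shows "minimally_resolves V I (case_nat [0] S) (case_nat (mat 1 (dim_vec g) (\<lambda>(_, b). g $ b)) D)"
proof -
  let ?g = "mat 1 (dim_vec g) (\<lambda>(_, b). g $ b)"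
  have gr: "graded_free_resolution V I S g D"
    and min: "\<And>i a b. a < length (S i) \<Longrightarrow> b < length (S (Suc i)) \<Longrightarrow> const_term (D i $$ (a, b)) = 0"
    using assms by (auto simp: minimal_graded_free_resolution_def const_term_def)
  have g: "g \<in> carrier_vec (length (S 0))"
    and gh: "\<And>a. a < length (S 0) \<Longrightarrow> g $ a \<in> homogeneous V (S 0 ! a)"
    and D: "\<And>i. D i \<in> gmat V (S i) (S (Suc i))"
    and im: "(\<lambda>v. g \<bullet> v) ` free_module V (length (S 0)) = I"
    and ex0: "{v \<in> free_module V (length (S 0)). g \<bullet> v = 0} =
       (\<lambda>w. D 0 *\<^sub>v w) ` free_module V (length (S 1))"
    and ex: "\<And>i. {v \<in> free_module V (length (S (Suc i))). D i *\<^sub>v v = 0\<^sub>v (length (S i))} =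
       (\<lambda>w. D (Suc i) *\<^sub>v w) ` free_module V (length (S (Suc (Suc i))))"
    using gr by (auto simp: graded_free_resolution_def gmat_def)
  have Dc: "D i \<in> carrier_mat (length (S i)) (length (S (Suc i)))" for i
    using D by (rule gmat_carrier)
  have row: "vec (dim_vec g) (($) g) = g"
    by (intro eq_vecI) auto
  have gv0: "?g *\<^sub>v v = 0\<^sub>v (Suc 0) \<longleftrightarrow> g \<bullet> v = 0" for v
    by (auto simp: vec_eq_iff row)
  have "resolves V I (case_nat [0] S) (case_nat ?g D)"
    unfolding resolves_def
  proof (intro conjI allI)
    fix i
    show "case_nat ?g D i \<in> gmat V (case_nat [0] S i) (case_nat [0] S (Suc i))"
      using D g gh by (cases i) (auto intro!: gmatI)
    show "kernel_module V (case_nat ?g D i) = image_module V (case_nat ?g D (Suc i))"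
    proof (cases i)
      case 0
      then show ?thesis
        using g Dc[of 0] ex0 by (simp add: kernel_module_def image_module_def gv0[unfolded carrier_vecD[OF g] One_nat_def])
    next
      case (Suc n)
      then show ?thesis
        using Dc[of n] Dc[of "Suc n"] ex[of n] by (simp add: kernel_module_def image_module_def)
    qed
  qed (use im in \<open>simp_all add: row\<close>)
  moreover have "map_mat const_term (D i) = 0\<^sub>m (length (S i)) (length (S (Suc i)))" for i
    using Dc[of i] min by (intro eq_matI) auto
  ultimately show ?thesis
    by (simp add: minimally_resolves_def)
qed

lemma resolves_minimal_graded_free_resolution:
  assumes "minimally_resolves V I T E"
  shows "minimal_graded_free_resolution V I (\<lambda>i. T (Suc i)) (row (E 0) 0) (\<lambda>i. E (Suc i))"
proof -
  have r: "resolves V I T E"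
    and min: "\<And>i. map_mat const_term (E (Suc i)) = 0\<^sub>m (length (T (Suc i))) (length (T (Suc (Suc i))))"
    using assms by (auto simp: minimally_resolves_def)
  have T0: "T 0 = [0]" using r by (rule resolves_T0)
  have c: "E i \<in> carrier_mat (length (T i)) (length (T (Suc i)))" for i
    using r by (rule resolves_carrier)
  have c0: "E 0 \<in> carrier_mat 1 (length (T (Suc 0)))"
    using c[of 0] T0 by simp
  have ent: "E i $$ (a, b) \<in> homogeneous V (T (Suc i) ! b - T i ! a)"
    if "a < length (T i)" "b < length (T (Suc i))" for i a b
    using gmat_entry[OF resolves_gmat[OF r] that] .
  have ent0: "E 0 $$ (0, b) \<in> homogeneous V (T (Suc 0) ! b)" if "b < length (T (Suc 0))" for b
    using ent[of 0 0 b] that T0 by simp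
  have z: "E 0 *\<^sub>v v = 0\<^sub>v (Suc 0) \<longleftrightarrow> row (E 0) 0 \<bullet> v = 0" for v
    using c0 by (auto simp: vec_eq_iff)
  have ker: "kernel_module V (E i) = image_module V (E (Suc i))" for i
    using r by (rule resolves_exact)
  have "graded_free_resolution V I (\<lambda>i. T (Suc i)) (row (E 0) 0) (\<lambda>i. E (Suc i))"
    unfolding graded_free_resolution_def
  proof (intro conjI allI impI)
    show "(\<lambda>v. row (E 0) 0 \<bullet> v) ` free_module V (length (T (Suc 0))) = I"
      using r c0 by (simp add: resolves_def)
    show "{v \<in> free_module V (length (T (Suc 0))). row (E 0) 0 \<bullet> v = 0} =
       (\<lambda>w. E (Suc 0) *\<^sub>v w) ` free_module V (length (T (Suc 1)))"
      using ker[of 0] c0 c[of "Suc 0"] by (simp add: kernel_module_def image_module_def z)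
    show "{v \<in> free_module V (length (T (Suc (Suc i)))). E (Suc i) *\<^sub>v v = 0\<^sub>v (length (T (Suc i)))} =
       (\<lambda>w. E (Suc (Suc i)) *\<^sub>v w) ` free_module V (length (T (Suc (Suc (Suc i)))))" for i
      using ker[of "Suc i"] c[of "Suc i"] c[of "Suc (Suc i)"]
      by (simp add: kernel_module_def image_module_def)
  qed (use c c0 ent ent0 in \<open>auto simp: row_def\<close>)
  moreover have "const_term (E (Suc i) $$ (a, b)) = 0"
    if "a < length (T (Suc i))" "b < length (T (Suc (Suc i)))" for i a b
  proof -
    have "const_term (E (Suc i) $$ (a, b)) = map_mat const_term (E (Suc i)) $$ (a, b)"
      using c[of "Suc i"] that by simp
    then show ?thesis
      unfolding min using that by simp
  qed
  ultimately show ?thesis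
    by (auto simp: minimal_graded_free_resolution_def const_term_def)
qed

text \<open>The given resolution plays two roles: it shows that the choice in
  \<open>graded_betti\<close> is made from a nonempty set, and it is then compared with the chosen
  one.\<close>

theorem graded_betti_eq_count:
  assumes m: "minimally_resolves V I T E"
  shows "graded_betti V I i j = count_list (T (Suc i)) j"
proof -
  let ?P = "\<lambda>S. \<exists>g D. minimal_graded_free_resolution V I S g D"
  have "?P (SOME S. ?P S)"
    using resolves_minimal_graded_free_resolution[OF m] by (intro someI[of ?P]) blast
  then obtain g D where "minimal_graded_free_resolution V I (SOME S. ?P S) g D"
    by blast
  from minimal_graded_free_resolution_resolves[OF this]
  obtain E' where m': "minimally_resolves V I (case_nat [0] (SOME S. ?P S)) E'" by blast
  have "count_list (case_nat [0] (SOME S. ?P S) (Suc i)) j = count_list (T (Suc i)) j"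
    by (intro antisym minimally_resolves_count_le[OF m' m] minimally_resolves_count_le[OF m m'])
  then show ?thesis
    by (simp add: graded_betti_def)
qed

section \<open>The mapping cone\<close>

lemma gmat_four_block:
  assumes A: "A \<in> gmat V T W" and B: "B \<in> gmat V T X" and D: "D \<in> gmat V U X"
  shows "four_block_mat A B (0\<^sub>m (length U) (length W)) D \<in> gmat V (T @ U) (W @ X)"
proof (rule gmatI)
  have c: "A \<in> carrier_mat (length T) (length W)" "B \<in> carrier_mat (length T) (length X)"
    "D \<in> carrier_mat (length U) (length X)"
    using A B D by (auto dest: gmat_carrier)
  then show "four_block_mat A B (0\<^sub>m (length U) (length W)) D
      \<in> carrier_mat (length (T @ U)) (length (W @ X))"
    by simp
  fix a b assume "a < length (T @ U)" "b < length (W @ X)"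
  then show "four_block_mat A B (0\<^sub>m (length U) (length W)) D $$ (a, b)
      \<in> homogeneous V ((W @ X) ! b - (T @ U) ! a)"
    using c gmat_entry[OF A, of a b] gmat_entry[OF B, of a "b - length W"]
      gmat_entry[OF D, of "a - length T" "b - length W"]
    by (auto simp: nth_append)
qed

lemma free_module_appendE:
  assumes "v \<in> free_module V (n + m)"
  obtains a b where "a \<in> free_module V n" "b \<in> free_module V m" "v = a @\<^sub>v b"
proof
  show "vec n (\<lambda>i. v $ i) \<in> free_module V n" "vec m (\<lambda>i. v $ (n + i)) \<in> free_module V m"
    using assms by (auto simp: free_module_def)
  show "v = vec n (\<lambda>i. v $ i) @\<^sub>v vec m (\<lambda>i. v $ (n + i))"
    using assms by (intro eq_vecI) (auto simp: free_module_def)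
qed

lemma free_module_append:
  "a \<in> free_module V n \<Longrightarrow> b \<in> free_module V m \<Longrightarrow> a @\<^sub>v b \<in> free_module V (n + m)"
  by (auto simp: free_module_def)

lemma append_eq_zero_vec:
  fixes a b :: "'a::zero vec"
  assumes "a \<in> carrier_vec n"
  shows "a @\<^sub>v b = 0\<^sub>v (n + m) \<longleftrightarrow> a = 0\<^sub>v n \<and> b = 0\<^sub>v m"
proof -
  have "0\<^sub>v (n + m) = 0\<^sub>v n @\<^sub>v (0\<^sub>v m :: 'a vec)"
    by (intro eq_vecI) auto
  then show ?thesis
    using assms by simp
qed

text \<open>Multiplication by \<open>p\<close> already maps \<open>J\<close> into \<open>I\<close>, so multiplication by \<open>x * p\<close> lifts to \<open>x\<close>
  times a chain map. Its entries lie in the ideal of \<open>x\<close>, which makes the cone minimal.\<close>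

theorem minimally_resolves_cone:
  fixes V :: "'v set" and I J :: "('v, 'k::field) mpoly set"
  assumes mI: "minimally_resolves V I T E" and mJ: "minimally_resolves V J T' E'"
    and x: "x \<in> homogeneous V 1" and p: "p \<in> homogeneous V e"
    and colon: "J = {r \<in> polys V. x * p * r \<in> I}"
    and pJ: "\<And>r. r \<in> J \<Longrightarrow> p * r \<in> I"
    and J0: "\<And>r. r \<in> J \<Longrightarrow> const_term r = 0"
  shows "\<exists>E''. minimally_resolves V {a + x * p * r | a r. a \<in> I \<and> r \<in> polys V}
     (case_nat [0] (\<lambda>i. T (Suc i) @ map ((+) (1 + e)) (T' i))) E''"
proof -
  have r: "resolves V I T E" and r': "resolves V J T' E'"
    and min: "\<And>i. map_mat const_term (E (Suc i)) = 0\<^sub>m (length (T (Suc i))) (length (T (Suc (Suc i))))"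
    and min': "\<And>i. map_mat const_term (E' (Suc i)) = 0\<^sub>m (length (T' (Suc i))) (length (T' (Suc (Suc i))))"
    using mI mJ by (auto simp: minimally_resolves_def)
  have T0: "T 0 = [0]" and T'0: "T' 0 = [0]"
    using r r' by (auto dest: resolves_T0)
  obtain f where f0: "f 0 = p \<cdot>\<^sub>m 1\<^sub>m 1" and f: "\<And>i. f i \<in> gmat V (T i) (map ((+) e) (T' i))"
    and Ef: "\<And>i. E i * f (Suc i) = f i * E' i"
    using resolves_lift[OF r' r p pJ] by blast
  define \<psi> where "\<psi> i = x \<cdot>\<^sub>m f i" for i
  \<comment> \<open>\<open>U\<close> is the shifted resolution of R/J moved up by one homological
    degree, so it is empty in degree 0. Accordingly \<open>G 0\<close> is the matrix with no rows
    and with one column for \<open>T' 0 = [0]\<close>. The sign in \<open>G\<close> makes the two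
    paths through the off-diagonal block cancel.\<close>
  define U where "U = case_nat [] (\<lambda>i. map ((+) (1 + e)) (T' i))"
  define G where "G = case_nat (0\<^sub>m 0 1) (\<lambda>i. - E' i)"
  define T'' where "T'' i = T i @ U i" for i
  define E'' where "E'' i = four_block_mat (E i) (\<psi> i) (0\<^sub>m (length (U i)) (length (T (Suc i)))) (G i)" for i
  have U_simps: "U 0 = []" "length (U (Suc i)) = length (T' i)" for i
    by (simp_all add: U_def)
  have \<psi>: "\<psi> i \<in> gmat V (T i) (U (Suc i))" for i
    unfolding \<psi>_def U_def using gmat_smult[OF f x] by simp
  have G: "G i \<in> gmat V (U i) (U (Suc i))" for i
  proof (cases i)
    case 0
    then show ?thesis by (auto simp: G_def U_def T'0 intro!: gmatI)
  next
    case (Suc n)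
    then show ?thesis
      using gmat_shift[OF gmat_uminus[OF resolves_gmat[OF r']]] by (simp add: G_def U_def)
  qed
  have Ec: "E i \<in> carrier_mat (length (T i)) (length (T (Suc i)))"
    and E'c: "E' i \<in> carrier_mat (length (T' i)) (length (T' (Suc i)))"
    and \<psi>c: "\<psi> i \<in> carrier_mat (length (T i)) (length (T' i))"
    and Gc: "G i \<in> carrier_mat (length (U i)) (length (T' i))"
    and fc: "f i \<in> carrier_mat (length (T i)) (length (T' i))" for i
    using resolves_carrier[OF r] resolves_carrier[OF r'] gmat_carrier[OF \<psi>[of i]]
      gmat_carrier[OF G[of i]] gmat_carrier[OF f[of i]] by (auto simp: U_simps)
  have E'': "E'' i \<in> gmat V (T'' i) (T'' (Suc i))" for i
    unfolding E''_def T''_def by (intro gmat_four_block resolves_gmat[OF r] \<psi> G)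
  have E''c: "E'' i \<in> carrier_mat (length (T i) + length (U i)) (length (T (Suc i)) + length (T' i))" for i
    using gmat_carrier[OF E''[of i]] by (simp add: T''_def U_simps)
  have app: "E'' i *\<^sub>v (a @\<^sub>v b) = (E i *\<^sub>v a + \<psi> i *\<^sub>v b) @\<^sub>v (G i *\<^sub>v b)"
    if "a \<in> carrier_vec (length (T (Suc i)))" "b \<in> carrier_vec (length (T' i))" for i a b
  proof -
    have "0\<^sub>m (length (U i)) (length (T (Suc i))) *\<^sub>v a + G i *\<^sub>v b = G i *\<^sub>v b"
      using that Gc[of i] by (intro eq_vecI) auto
    then show ?thesis
      unfolding E''_def
      using four_block_mat_mult_vec[OF Ec[of i] \<psi>c[of i] zero_carrier_mat Gc[of i] that] by simp
  qed
  have app_zero: "E'' i *\<^sub>v (a @\<^sub>v b) = 0\<^sub>v (length (T i) + length (U i)) \<longleftrightarrow>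
      E i *\<^sub>v a + \<psi> i *\<^sub>v b = 0\<^sub>v (length (T i)) \<and> G i *\<^sub>v b = 0\<^sub>v (length (U i))"
    if "a \<in> carrier_vec (length (T (Suc i)))" "b \<in> carrier_vec (length (T' i))" for i a b
    unfolding app[OF that] using Ec[of i] \<psi>c[of i] that by (intro append_eq_zero_vec) auto
  have EE: "E i *\<^sub>v (E (Suc i) *\<^sub>v a) = 0\<^sub>v (length (T i))"
    if "a \<in> carrier_vec (length (T (Suc (Suc i))))" for i a
  proof -
    have "E i *\<^sub>v (E (Suc i) *\<^sub>v a) = (E i * E (Suc i)) *\<^sub>v a"
      using Ec[of i] Ec[of "Suc i"] that by simp
    then show ?thesis
      unfolding resolves_complex[OF r] using that by auto
  qed
  have EE': "E' i *\<^sub>v (E' (Suc i) *\<^sub>v a) = 0\<^sub>v (length (T' i))"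
    if "a \<in> carrier_vec (length (T' (Suc (Suc i))))" for i a
  proof -
    have "E' i *\<^sub>v (E' (Suc i) *\<^sub>v a) = (E' i * E' (Suc i)) *\<^sub>v a"
      using E'c[of i] E'c[of "Suc i"] that by simp
    then show ?thesis
      unfolding resolves_complex[OF r'] using that by auto
  qed
  have E\<psi>: "E i *\<^sub>v (\<psi> (Suc i) *\<^sub>v w) = \<psi> i *\<^sub>v (E' i *\<^sub>v w)"
    if "w \<in> carrier_vec (length (T' (Suc i)))" for i w
  proof -
    have "E i * \<psi> (Suc i) = x \<cdot>\<^sub>m (E i * f (Suc i))"
      unfolding \<psi>_def by (rule mult_smult_distrib[OF Ec fc])
    also have "\<dots> = \<psi> i * E' i"
      unfolding \<psi>_def Ef by (rule mult_smult_assoc_mat[OF fc E'c, symmetric])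
    finally have "(E i * \<psi> (Suc i)) *\<^sub>v w = (\<psi> i * E' i) *\<^sub>v w"
      by simp
    then show ?thesis
      using Ec[of i] \<psi>c[of "Suc i"] \<psi>c[of i] E'c[of i] that by simp
  qed
  have Suc_split: "free_module V (length (T'' (Suc i))) = free_module V (length (T (Suc i)) + length (T' i))" for i
    by (simp add: T''_def U_simps)
  have \<psi>0: "(\<psi> 0 *\<^sub>v b) $ 0 = x * p * b $ 0" if "b \<in> carrier_vec 1" for b
    using that by (simp add: \<psi>_def f0 T0 T'0 scalar_prod_def mult.assoc)
  have "resolves V {a + x * p * r | a r. a \<in> I \<and> r \<in> polys V} T'' E''"
    unfolding resolves_def
  proof (intro conjI allI)
    show "T'' 0 = [0]"
      by (simp add: T''_def U_simps T0)
    show "(\<lambda>w. (E'' 0 *\<^sub>v w) $ 0) ` free_module V (length (T'' 1)) =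
        {a + x * p * r | a r. a \<in> I \<and> r \<in> polys V}" (is "?L = ?R")
    proof -
      have val: "(E'' 0 *\<^sub>v (a @\<^sub>v b)) $ 0 = (E 0 *\<^sub>v a) $ 0 + x * p * b $ 0"
        if "a \<in> carrier_vec (length (T 1))" "b \<in> carrier_vec 1" for a b
      proof -
        have d: "dim_row (E 0) = 1" "dim_row (\<psi> 0) = 1"
          using Ec[of 0] \<psi>c[of 0] T0 by auto
        have "E'' 0 *\<^sub>v (a @\<^sub>v b) = (E 0 *\<^sub>v a + \<psi> 0 *\<^sub>v b) @\<^sub>v (G 0 *\<^sub>v b)"
          using that by (intro app) (auto simp: T'0)
        then have "(E'' 0 *\<^sub>v (a @\<^sub>v b)) $ 0 = (E 0 *\<^sub>v a) $ 0 + (\<psi> 0 *\<^sub>v b) $ 0"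
          using d by (simp del: index_mult_mat_vec)
        then show ?thesis
          using \<psi>0[OF that(2)] by simp
      qed
      have I: "I = (\<lambda>w. (E 0 *\<^sub>v w) $ 0) ` free_module V (length (T 1))"
        using r by (simp add: resolves_def)
      have sp: "free_module V (length (T'' 1)) = free_module V (length (T 1) + 1)"
        using Suc_split[of 0] by (simp add: T'0)
      show ?thesis
      proof (intro equalityI subsetI)
        fix y assume "y \<in> ?L"
        then obtain v where v: "v \<in> free_module V (length (T 1) + 1)" and y: "y = (E'' 0 *\<^sub>v v) $ 0"
          using sp by auto
        from free_module_appendE[OF v] obtain a b
          where a: "a \<in> free_module V (length (T 1))" and b: "b \<in> free_module V 1"
            and "v = a @\<^sub>v b" .
        then have "y = (E 0 *\<^sub>v a) $ 0 + x * p * b $ 0"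
          using y val free_module_carrier by blast
        moreover have "b $ 0 \<in> polys V"
          using b by (simp add: free_module_def)
        ultimately show "y \<in> ?R"
          using a I by blast
      next
        fix y assume "y \<in> ?R"
        then obtain a s where a: "a \<in> free_module V (length (T 1))" and s: "s \<in> polys V"
          and y: "y = (E 0 *\<^sub>v a) $ 0 + x * p * s"
          unfolding I by blast
        let ?b = "vec 1 (\<lambda>_. s)"
        have b: "?b \<in> free_module V 1"
          using s by (simp add: free_module_def)
        have "y = (E'' 0 *\<^sub>v (a @\<^sub>v ?b)) $ 0"
          using val[OF free_module_carrier[OF a] free_module_carrier[OF b]] y by simp
        then show "y \<in> ?L"
          unfolding sp using free_module_append[OF a b] by blast
      qed
    qed
    fix i
    show "E'' i \<in> gmat V (T'' i) (T'' (Suc i))"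
      by (rule E'')
    show "kernel_module V (E'' i) = image_module V (E'' (Suc i))"
    proof (intro equalityI subsetI)
      fix v assume "v \<in> kernel_module V (E'' i)"
      then have v: "v \<in> free_module V (length (T (Suc i)) + length (T' i))"
        and zero: "E'' i *\<^sub>v v = 0\<^sub>v (length (T i) + length (U i))"
        using E''c[of i] by (auto simp: kernel_module_def)
      from free_module_appendE[OF v] obtain a b
        where a: "a \<in> free_module V (length (T (Suc i)))" and b: "b \<in> free_module V (length (T' i))"
          and vab: "v = a @\<^sub>v b" .
      note ac = free_module_carrier[OF a] and bc = free_module_carrier[OF b]
      have z1: "E i *\<^sub>v a + \<psi> i *\<^sub>v b = 0\<^sub>v (length (T i))" and z2: "G i *\<^sub>v b = 0\<^sub>v (length (U i))"
        using zero app_zero[OF ac bc] unfolding vab by auto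
      \<comment> \<open>Vanishing of the second component makes \<open>b\<close> a cycle, except for
        \<open>i = 0\<close>, where \<open>G 0\<close> imposes nothing. There the first component
        says that \<open>x * p\<close> times the entry of \<open>b\<close> lies in \<open>I\<close>,
        and the colon ideal takes over: R/J(-1-e) -> R/I is injective.\<close>
      have "b \<in> image_module V (E' i)"
      proof (cases i)
        case 0
        have b1: "b \<in> carrier_vec 1"
          using bc by (simp add: 0 T'0)
        have d: "dim_row (E 0) = 1" "dim_row (\<psi> 0) = 1"
          using Ec[of 0] \<psi>c[of 0] T0 by auto
        have "(E 0 *\<^sub>v a) $ 0 + (\<psi> 0 *\<^sub>v b) $ 0 = (E 0 *\<^sub>v a + \<psi> 0 *\<^sub>v b) $ 0"
          using d by (simp del: index_mult_mat_vec)
        also have "\<dots> = 0"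
          using z1 by (simp add: 0 T0)
        finally have "x * p * b $ 0 = - (E 0 *\<^sub>v a) $ 0"
          unfolding \<psi>0[OF b1] by (simp add: add_eq_0_iff2 del: index_mult_mat_vec)
        also have "\<dots> = (E 0 *\<^sub>v (- a)) $ 0"
          using Ec[of 0] ac d by (simp add: 0)
        also have "\<dots> \<in> I"
          using r free_module_uminus[OF a] unfolding resolves_def 0 One_nat_def by blast
        finally have "b $ 0 \<in> J"
          using b by (simp add: colon free_module_def 0 T'0)
        then show ?thesis
          using resolves_mem_iff[OF r' b1] by (simp add: 0)
      next
        case (Suc n)
        have "- (E' n *\<^sub>v b) = 0\<^sub>v (length (T' n))"
          using z2 bc E'c[of n] by (simp add: Suc G_def U_simps)
        then have "E' n *\<^sub>v b = 0\<^sub>v (length (T' n))"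
          using E'c[of n] by (auto simp: vec_eq_iff simp del: index_mult_mat_vec)
        then show ?thesis
          using b E'c[of n] resolves_exact[OF r', of n] by (auto simp: Suc kernel_module_def)
      qed
      then obtain w where w: "w \<in> free_module V (length (T' (Suc i)))" and bw: "b = E' i *\<^sub>v w"
        using E'c[of i] by (auto simp: image_module_def)
      note wc = free_module_carrier[OF w]
      \<comment> \<open>Adding the image of \<open>w\<close> turns \<open>a\<close> into a cycle of
        the first complex, hence into \<open>E (Suc i)\<close> applied to some \<open>z\<close>. The
        preimage of \<open>v\<close> is then \<open>z\<close> followed by \<open>- w\<close>, the
        sign compensating that of \<open>G\<close>.\<close>
      have \<psi>w: "\<psi> (Suc i) *\<^sub>v w \<in> free_module V (length (T (Suc i)))"
        using gmat_mult_vec[OF \<psi>, of w "Suc i"] w by (simp add: U_simps)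
      have "E i *\<^sub>v (a + \<psi> (Suc i) *\<^sub>v w) = E i *\<^sub>v a + E i *\<^sub>v (\<psi> (Suc i) *\<^sub>v w)"
        by (rule mult_add_distrib_mat_vec[OF Ec ac free_module_carrier[OF \<psi>w]])
      also have "\<dots> = 0\<^sub>v (length (T i))"
        unfolding E\<psi>[OF wc] bw[symmetric] by (rule z1)
      finally have "a + \<psi> (Suc i) *\<^sub>v w \<in> kernel_module V (E i)"
        using free_module_add[OF a \<psi>w] Ec[of i] by (simp add: kernel_module_def)
      then obtain z where z: "z \<in> free_module V (length (T (Suc (Suc i))))"
        and az: "a + \<psi> (Suc i) *\<^sub>v w = E (Suc i) *\<^sub>v z"
        using Ec[of "Suc i"] unfolding resolves_exact[OF r] image_module_def by auto
      note zc = free_module_carrier[OF z]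
      have mw: "- w \<in> free_module V (length (T' (Suc i)))"
        by (rule free_module_uminus[OF w])
      have neg: "M *\<^sub>v (- w) = - (M *\<^sub>v w)" if "M \<in> carrier_mat n (length (T' (Suc i)))" for M n
        using that wc by (intro eq_vecI) auto
      have "E (Suc i) *\<^sub>v z + \<psi> (Suc i) *\<^sub>v (- w) = a"
        unfolding az[symmetric] neg[OF \<psi>c] using ac free_module_carrier[OF \<psi>w]
        by (intro eq_vecI) (auto simp del: index_mult_mat_vec)
      moreover have "G (Suc i) *\<^sub>v (- w) = b"
        unfolding neg[OF Gc] using wc E'c[of i] by (simp add: G_def bw)
      ultimately have "E'' (Suc i) *\<^sub>v (z @\<^sub>v (- w)) = v"
        using app[OF zc free_module_carrier[OF mw]] by (simp add: vab)
      then show "v \<in> image_module V (E'' (Suc i))"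
        using free_module_append[OF z mw] E''c[of "Suc i"] unfolding image_module_def by force
    next
      fix v assume "v \<in> image_module V (E'' (Suc i))"
      then obtain u where u: "u \<in> free_module V (length (T (Suc (Suc i))) + length (T' (Suc i)))"
        and vu: "v = E'' (Suc i) *\<^sub>v u"
        using E''c[of "Suc i"] by (auto simp: image_module_def)
      from free_module_appendE[OF u] obtain a b
        where a: "a \<in> free_module V (length (T (Suc (Suc i))))"
          and b: "b \<in> free_module V (length (T' (Suc i)))" and uab: "u = a @\<^sub>v b" .
      note ac = free_module_carrier[OF a] and bc = free_module_carrier[OF b]
      have u': "u \<in> free_module V (length (T'' (Suc (Suc i))))"
        using u by (simp add: T''_def U_simps)
      have vf: "v \<in> free_module V (length (T (Suc i)) + length (T' i))"
        unfolding vu using gmat_mult_vec[OF E'' u'] by (simp add: T''_def U_simps)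
      let ?a = "E (Suc i) *\<^sub>v a + \<psi> (Suc i) *\<^sub>v b" and ?b = "G (Suc i) *\<^sub>v b"
      have v: "v = ?a @\<^sub>v ?b"
        unfolding vu uab by (rule app[OF ac bc])
      have Ea: "E (Suc i) *\<^sub>v a \<in> carrier_vec (length (T (Suc i)))"
        and \<psi>b: "\<psi> (Suc i) *\<^sub>v b \<in> carrier_vec (length (T (Suc i)))"
        and E'b: "E' i *\<^sub>v b \<in> carrier_vec (length (T' i))"
        using Ec[of "Suc i"] \<psi>c[of "Suc i"] E'c[of i] ac bc by auto
      have b': "?b = - (E' i *\<^sub>v b)"
        using E'c[of i] bc by (simp add: G_def)
      have neg: "M *\<^sub>v (- y) = - (M *\<^sub>v y)"
        if "M \<in> carrier_mat n m" "y \<in> carrier_vec m" for M :: "('v, 'k) mpoly mat" and n m y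
        using that by (intro eq_vecI) auto
      have "E i *\<^sub>v ?a + \<psi> i *\<^sub>v ?b = 0\<^sub>v (length (T i))"
        unfolding b' neg[OF \<psi>c E'b] mult_add_distrib_mat_vec[OF Ec Ea \<psi>b] EE[OF ac] E\<psi>[OF bc]
        using mult_mat_vec_carrier[OF \<psi>c E'b] by (intro eq_vecI) (auto simp del: index_mult_mat_vec)
      moreover have "G i *\<^sub>v ?b = 0\<^sub>v (length (U i))"
      proof (cases i)
        case 0
        then show ?thesis by (auto simp: G_def U_simps)
      next
        case (Suc n)
        have "E' n *\<^sub>v (E' i *\<^sub>v b) = 0\<^sub>v (length (T' n))"
          unfolding Suc using bc by (intro EE') (simp add: Suc)
        then have "E' n *\<^sub>v ?b = 0\<^sub>v (length (T' n))"
          using neg[OF E'c[of n], of "E' i *\<^sub>v b"] E'b unfolding b' by (simp add: Suc)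
        moreover have "?b \<in> carrier_vec (length (T' i))"
          unfolding b' using E'b by simp
        ultimately show ?thesis
          using E'c[of n] E'c[of i] by (simp add: Suc G_def U_simps)
      qed
      ultimately have "E'' i *\<^sub>v v = 0\<^sub>v (length (T i) + length (U i))"
        unfolding v using Ea \<psi>b E'b b' by (subst app_zero) auto
      then show "v \<in> kernel_module V (E'' i)"
        using vf E''c[of i] by (simp add: kernel_module_def)
    qed
  qed
  moreover have "map_mat const_term (E'' (Suc i)) = 0\<^sub>m (length (T'' (Suc i))) (length (T'' (Suc (Suc i))))" for i
  proof -
    have constE: "const_term (E (Suc i) $$ (a, b)) = 0"
      if "a < length (T (Suc i))" "b < length (T (Suc (Suc i)))" for a b
    proof -
      have "const_term (E (Suc i) $$ (a, b)) = map_mat const_term (E (Suc i)) $$ (a, b)"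
        using Ec[of "Suc i"] that by simp
      then show ?thesis
        unfolding min using that by simp
    qed
    \<comment> \<open>For \<open>i = 0\<close> this concerns \<open>E' 0\<close>, which minimality
      of the given resolution leaves free but which becomes an inner differential of the cone. Its
      entries lie in \<open>J\<close>, so \<open>J0\<close> removes their constant terms.\<close>
    have constE': "const_term (E' i $$ (a, b)) = 0"
      if "a < length (T' i)" "b < length (T' (Suc i))" for a b
    proof (cases i)
      case 0
      then have a: "a = 0" using that by (simp add: T'0)
      have c: "E' 0 \<in> carrier_mat 1 (length (T' 1))"
        using E'c[of 0] by (simp add: T'0)
      have "col (E' 0) b \<in> image_module V (E' 0)"
        using that c 0 by (intro col_in_image[OF c]) simp
      moreover have "col (E' 0) b \<in> carrier_vec 1"
        using c by (simp only: carrier_vec_def dim_col carrier_matD(1)[OF c] mem_Collect_eq)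
      ultimately have "col (E' 0) b $ 0 \<in> J"
        using resolves_mem_iff[OF r'] by blast
      then show ?thesis
        using J0 that c by (simp add: 0 a)
    next
      case (Suc n)
      have "const_term (E' i $$ (a, b)) = map_mat const_term (E' (Suc n)) $$ (a, b)"
        using E'c[of "Suc n"] that by (simp add: Suc)
      then show ?thesis
        unfolding min' using that by (simp add: Suc)
    qed
    have constx: "const_term x = 0"
      using const_homogeneous[OF x] by auto
    show ?thesis
    proof (rule eq_matI)
      fix a b
      assume "a < dim_row (0\<^sub>m (length (T'' (Suc i))) (length (T'' (Suc (Suc i)))) :: 'k mat)"
        and "b < dim_col (0\<^sub>m (length (T'' (Suc i))) (length (T'' (Suc (Suc i)))) :: 'k mat)"
      then have ab: "a < length (T (Suc i)) + length (T' i)"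
        "b < length (T (Suc (Suc i))) + length (T' (Suc i))"
        by (simp_all add: T''_def U_simps)
      have dims: "dim_row (E (Suc i)) = length (T (Suc i))" "dim_col (E (Suc i)) = length (T (Suc (Suc i)))"
        "dim_row (f (Suc i)) = length (T (Suc i))" "dim_col (f (Suc i)) = length (T' (Suc i))"
        "dim_row (E' i) = length (T' i)" "dim_col (E' i) = length (T' (Suc i))"
        using Ec[of "Suc i"] fc[of "Suc i"] E'c[of i] by auto
      have "const_term (E'' (Suc i) $$ (a, b)) = 0"
        unfolding E''_def G_def \<psi>_def
        using ab by (auto simp: dims U_simps constE constE' constx const_hom.hom_uminus const_hom.hom_mult)
      then show "map_mat const_term (E'' (Suc i)) $$ (a, b) =
          0\<^sub>m (length (T'' (Suc i))) (length (T'' (Suc (Suc i)))) $$ (a, b)"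
        using ab E''c[of "Suc i"] by (simp add: T''_def U_simps)
    qed (use E''c[of "Suc i"] in \<open>auto simp: T''_def U_simps\<close>)
  qed
  moreover have "T'' = case_nat [0] (\<lambda>i. T (Suc i) @ map ((+) (1 + e)) (T' i))"
    by (auto simp: T''_def U_def T0 split: nat.split)
  ultimately show ?thesis
    unfolding minimally_resolves_def by metis
qed

section \<open>Squarefree monomial ideals\<close>

definition sqfree_exp :: "'v set \<Rightarrow> 'v \<Rightarrow>\<^sub>0 nat" where
  "sqfree_exp F = (\<Sum>x\<in>F. Poly_Mapping.single x 1)"

abbreviation monom_of :: "'v set \<Rightarrow> ('v, 'k::field) mpoly" where
  "monom_of F \<equiv> Poly_Mapping.single (sqfree_exp F) 1"

lemma lookup_sqfree_exp: "finite F \<Longrightarrow> Poly_Mapping.lookup (sqfree_exp F) x = (if x \<in> F then 1 else 0)"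
  by (simp add: sqfree_exp_def lookup_sum lookup_single when_def)

lemma keys_sqfree_exp: "finite F \<Longrightarrow> Poly_Mapping.keys (sqfree_exp F) = F"
  by (auto simp: in_keys_iff lookup_sqfree_exp split: if_splits)

lemma prod_var: "finite F \<Longrightarrow> (\<Prod>x\<in>F. var x) = monom_of F"
  by (induction F rule: finite_induct) (auto simp: sqfree_exp_def var_def mult_single)

lemma total_degree_sqfree_exp: "finite F \<Longrightarrow> total_degree (sqfree_exp F) = card F"
  by (simp add: total_degree_def keys_sqfree_exp lookup_sqfree_exp)

lemma monom_of_homogeneous:
  "finite F \<Longrightarrow> F \<subseteq> V \<Longrightarrow> monom_of F \<in> homogeneous V (int (card F))"
  by (simp add: homogeneous_def polys_def keys_sqfree_exp total_degree_sqfree_exp)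

lemma monom_of_split:
  assumes "finite F" "x \<in> F"
  shows "monom_of F = var x * monom_of (F - {x})"
  using assms by (simp add: var_def mult_single sqfree_exp_def sum.remove)

lemma sum_monomials:
  "p = (\<Sum>m\<in>Poly_Mapping.keys p. Poly_Mapping.single m (Poly_Mapping.lookup p m))"
  by (rule poly_mapping_eqI) (auto simp: lookup_sum lookup_single when_def in_keys_iff)

lemma keys_single_mult:
  fixes p :: "('v, 'k::field) mpoly"
  shows "Poly_Mapping.keys (Poly_Mapping.single u 1 * p) = (+) u ` Poly_Mapping.keys p"
proof -
  have "Poly_Mapping.single u 1 * p =
      (\<Sum>m\<in>Poly_Mapping.keys p. Poly_Mapping.single (u + m) (Poly_Mapping.lookup p m))"
    by (subst sum_monomials[of p]) (simp add: sum_distrib_left mult_single)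
  then have "Poly_Mapping.lookup (Poly_Mapping.single u 1 * p) k =
      (\<Sum>m\<in>Poly_Mapping.keys p. if u + m = k then Poly_Mapping.lookup p m else 0)" for k
    by (simp add: lookup_sum lookup_single when_def)
  moreover have "(\<Sum>m\<in>Poly_Mapping.keys p. if u + m = u + n then Poly_Mapping.lookup p m else 0) =
      Poly_Mapping.lookup p n" for n
    by (simp add: in_keys_iff)
  moreover have "(\<Sum>m\<in>Poly_Mapping.keys p. if u + m = k then Poly_Mapping.lookup p m else 0) = 0"
    if "k \<notin> (+) u ` Poly_Mapping.keys p" for k
    using that by (intro sum.neutral) auto
  ultimately show ?thesis
    by (fastforce simp: in_keys_iff)
qed

text \<open>The ideal generated by the squarefree monomials of the members of \<open>A\<close>,
  described by the monomials it contains: such a generator divides a monomial exactly when its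
  vertices lie in the support.\<close>

definition mideal :: "'v set \<Rightarrow> 'v set set \<Rightarrow> ('v, 'k::field) mpoly set" where
  "mideal V A = {p \<in> polys V. \<forall>m\<in>Poly_Mapping.keys p. \<exists>F\<in>A. F \<subseteq> Poly_Mapping.keys m}"

lemma mideal_empty: "mideal V {} = ({0} :: ('v, 'k::field) mpoly set)"
proof -
  have "p = 0" if "\<forall>m. m \<notin> Poly_Mapping.keys p" for p :: "('v, 'k) mpoly"
    using that by (intro poly_mapping_eqI) (simp add: in_keys_iff)
  then show ?thesis by (auto simp: mideal_def)
qed

text \<open>Multiplication by a monomial translates exponents without cancellation, so every support
  is merely enlarged by \<open>F\<close>.\<close>

lemma monom_of_mult_mideal_iff:
  assumes "finite F" "F \<subseteq> V" "p \<in> polys V"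
  shows "monom_of F * p \<in> mideal V A \<longleftrightarrow>
    (\<forall>m\<in>Poly_Mapping.keys p. \<exists>G\<in>A. G \<subseteq> F \<union> Poly_Mapping.keys m)"
proof -
  have "monom_of F * p \<in> polys V"
    using assms homogeneous_imp_polys[OF monom_of_homogeneous] by (intro polys_mult) auto
  then show ?thesis
    using assms(1) by (simp add: mideal_def keys_single_mult keys_add_nat keys_sqfree_exp)
qed

text \<open>The monomials of \<open>p\<close> divisible by a generator from \<open>A\<close> are
  collected in \<open>a\<close>; each of the others is divisible by the monomial of
  \<open>F\<close>, and dividing gives \<open>r\<close>.\<close>

lemma mideal_insert:
  assumes F: "finite F" "F \<subseteq> V"
  shows "(mideal V (insert F A) :: ('v, 'k::field) mpoly set) =
    {a + monom_of F * r | a r. a \<in> mideal V A \<and> r \<in> polys V}"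
proof (intro equalityI subsetI)
  fix p :: "('v, 'k) mpoly" assume p: "p \<in> mideal V (insert F A)"
  define K where "K = {m \<in> Poly_Mapping.keys p. \<exists>G\<in>A. G \<subseteq> Poly_Mapping.keys m}"
  define a where "a = (\<Sum>m\<in>K. Poly_Mapping.single m (Poly_Mapping.lookup p m))"
  \<comment> \<open>Subtraction of exponents is truncated, but it is exact here: outside
    \<open>K\<close> the support of \<open>m\<close> contains \<open>F\<close>.\<close>
  define r where "r = (\<Sum>m\<in>Poly_Mapping.keys p - K. Poly_Mapping.single (m - sqfree_exp F) (Poly_Mapping.lookup p m))"
  have KV: "Poly_Mapping.keys m \<subseteq> V" if "m \<in> Poly_Mapping.keys p" for m
    using p that by (auto simp: mideal_def polys_def)
  have ka: "Poly_Mapping.keys a \<subseteq> K"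
  proof
    fix n assume n: "n \<in> Poly_Mapping.keys a"
    show "n \<in> K"
    proof (rule ccontr)
      assume "n \<notin> K"
      then have "Poly_Mapping.lookup a n = 0"
        unfolding a_def lookup_sum by (intro sum.neutral) (auto simp: lookup_single when_def)
      with n show False by (simp add: in_keys_iff)
    qed
  qed
  have "a \<in> mideal V A"
    unfolding mideal_def polys_def
  proof (intro CollectI conjI ballI)
    fix m assume "m \<in> Poly_Mapping.keys a"
    then have "m \<in> Poly_Mapping.keys p \<and> (\<exists>G\<in>A. G \<subseteq> Poly_Mapping.keys m)"
      using ka unfolding K_def by blast
    then show "Poly_Mapping.keys m \<subseteq> V" "\<exists>G\<in>A. G \<subseteq> Poly_Mapping.keys m"
      using KV by blast+
  qed
  moreover have "r \<in> polys V"
    unfolding r_def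
  proof (rule polys_sum)
    fix m assume "m \<in> Poly_Mapping.keys p - K"
    then have "Poly_Mapping.keys m \<subseteq> V"
      using KV by blast
    moreover have "Poly_Mapping.keys (m - sqfree_exp F) \<subseteq> Poly_Mapping.keys m"
      by (auto simp: in_keys_iff lookup_minus)
    ultimately show "Poly_Mapping.single (m - sqfree_exp F) (Poly_Mapping.lookup p m) \<in> polys V"
      by (auto simp: polys_def)
  qed
  moreover have "p = a + monom_of F * r"
  proof -
    have "monom_of F * r = (\<Sum>m\<in>Poly_Mapping.keys p - K. Poly_Mapping.single m (Poly_Mapping.lookup p m))"
      unfolding r_def sum_distrib_left
    proof (rule sum.cong)
      fix m assume "m \<in> Poly_Mapping.keys p - K"
      then have "F \<subseteq> Poly_Mapping.keys m"
        using p by (auto simp: mideal_def K_def)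
      then have "sqfree_exp F + (m - sqfree_exp F) = m"
        using F(1) by (intro poly_mapping_eqI)
          (auto simp: lookup_add lookup_minus lookup_sqfree_exp in_keys_iff subset_iff Suc_le_eq)
      then show "monom_of F * Poly_Mapping.single (m - sqfree_exp F) (Poly_Mapping.lookup p m) =
          Poly_Mapping.single m (Poly_Mapping.lookup p m)"
        by (simp add: mult_single)
    qed simp
    moreover have "p = a + (\<Sum>m\<in>Poly_Mapping.keys p - K. Poly_Mapping.single m (Poly_Mapping.lookup p m))"
    proof -
      have "K \<subseteq> Poly_Mapping.keys p"
        by (auto simp: K_def)
      note sum.subset_diff[OF this finite_keys, of "\<lambda>m. Poly_Mapping.single m (Poly_Mapping.lookup p m)"]
      then show ?thesis
        unfolding a_def by (simp add: sum_monomials[symmetric] add.commute)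
    qed
    ultimately show ?thesis by simp
  qed
  ultimately show "p \<in> {a + monom_of F * r | a r. a \<in> mideal V A \<and> r \<in> polys V}"
    by blast
next
  fix p :: "('v, 'k) mpoly" assume "p \<in> {a + monom_of F * r | a r. a \<in> mideal V A \<and> r \<in> polys V}"
  then obtain a r where p: "p = a + monom_of F * r" and a: "a \<in> mideal V A" and r: "r \<in> polys V"
    by blast
  have "monom_of F * r \<in> mideal V (insert F A)"
    using monom_of_mult_mideal_iff[OF F r] by auto
  moreover have "a \<in> mideal V (insert F A)"
    using a by (auto simp: mideal_def)
  ultimately show "p \<in> mideal V (insert F A)"
    using Poly_Mapping.keys_add[of a "monom_of F * r"] unfolding p
    by (auto simp: mideal_def polys_add)
qed

lemma span_eq_mideal:
  assumes "finite A" "\<And>F. F \<in> A \<Longrightarrow> finite F \<and> F \<subseteq> V"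
  shows "{\<Sum>F\<in>A. c F * (\<Prod>x\<in>F. var x) | c. \<forall>F\<in>A. c F \<in> polys V} = (mideal V A :: ('v, 'k::field) mpoly set)"
  using assms
proof (induction A rule: finite_induct)
  case empty
  then show ?case by (simp add: mideal_empty)
next
  case (insert F A)
  let ?S = "\<lambda>A. {\<Sum>F\<in>A. c F * (\<Prod>x\<in>F. var x) | c. \<forall>F\<in>A. c F \<in> polys V} :: ('v, 'k) mpoly set"
  have F: "finite F" "F \<subseteq> V"
    using insert.prems by auto
  have IH: "?S A = mideal V A"
    using insert.prems by (intro insert.IH) auto
  have "?S (insert F A) = {a + monom_of F * r | a r. a \<in> ?S A \<and> r \<in> polys V}"
  proof (intro equalityI subsetI)
    fix p assume "p \<in> ?S (insert F A)"
    then obtain c where c: "\<forall>G\<in>insert F A. c G \<in> polys V"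
      and "p = (\<Sum>G\<in>insert F A. c G * (\<Prod>x\<in>G. var x))"
      by blast
    then have "p = (\<Sum>G\<in>A. c G * (\<Prod>x\<in>G. var x)) + monom_of F * c F"
      using insert.hyps by (simp add: prod_var[OF F(1)] ac_simps)
    moreover have "(\<Sum>G\<in>A. c G * (\<Prod>x\<in>G. var x)) \<in> ?S A"
      using c by blast
    ultimately show "p \<in> {a + monom_of F * r | a r. a \<in> ?S A \<and> r \<in> polys V}"
      using c by blast
  next
    fix p assume "p \<in> {a + monom_of F * r | a r. a \<in> ?S A \<and> r \<in> polys V}"
    then obtain c r where c: "\<forall>G\<in>A. c G \<in> polys V" and r: "r \<in> polys V"
      and p: "p = (\<Sum>G\<in>A. c G * (\<Prod>x\<in>G. var x)) + monom_of F * r"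
      by blast
    have "(\<Sum>G\<in>insert F A. (c(F := r)) G * (\<Prod>x\<in>G. var x)) =
        r * monom_of F + (\<Sum>G\<in>A. (c(F := r)) G * (\<Prod>x\<in>G. var x))"
      using insert.hyps by (simp add: prod_var[OF F(1)])
    also have "(\<Sum>G\<in>A. (c(F := r)) G * (\<Prod>x\<in>G. var x)) = (\<Sum>G\<in>A. c G * (\<Prod>x\<in>G. var x))"
      using insert.hyps by (intro sum.cong) auto
    finally have "p = (\<Sum>G\<in>insert F A. (c(F := r)) G * (\<Prod>x\<in>G. var x))"
      using p by (simp add: ac_simps)
    moreover have "\<forall>G\<in>insert F A. (c(F := r)) G \<in> polys V"
      using c r by auto
    ultimately show "p \<in> ?S (insert F A)"
      by blast
  qed
  then show ?case
    unfolding IH mideal_insert[OF F] .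
qed

lemma facet_ideal_eq_mideal:
  assumes "finite V" "\<And>F. F \<in> facets \<Gamma> \<Longrightarrow> F \<subseteq> V"
  shows "facet_ideal V \<Gamma> = mideal V (facets \<Gamma>)"
proof -
  have "finite (facets \<Gamma>)"
    using assms by (meson Pow_iff finite_Pow_iff finite_subset subsetI)
  then show ?thesis
    unfolding facet_ideal_def using assms finite_subset by (intro span_eq_mideal) blast+
qed

section \<open>Leaves and localizations\<close>

text \<open>From here on a complex is replaced by its family of facets. Being an antichain is what
  allows a family to be recovered as the facets of the complex it spans.\<close>

definition antichain :: "'v set set \<Rightarrow> bool" where
  "antichain A \<longleftrightarrow> (\<forall>F\<in>A. \<forall>G\<in>A. F \<subseteq> G \<longrightarrow> F = G)"

definition leaf_in :: "'v set set \<Rightarrow> 'v set \<Rightarrow> bool" where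
  "leaf_in A F \<longleftrightarrow> F \<in> A \<and> (A = {F} \<or> (\<exists>G\<in>A. G \<noteq> F \<and> (\<forall>H\<in>A. H \<noteq> F \<longrightarrow> F \<inter> H \<subseteq> G)))"

definition forest :: "'v set set \<Rightarrow> bool" where
  "forest A \<longleftrightarrow> (\<forall>B\<subseteq>A. B \<noteq> {} \<longrightarrow> (\<exists>F. leaf_in B F))"

definition loc :: "'v set set \<Rightarrow> 'v set \<Rightarrow> 'v set set" where
  "loc A F = {B \<in> (\<lambda>G. G - F) ` A. \<forall>C\<in>(\<lambda>G. G - F) ` A. C \<subseteq> B \<longrightarrow> C = B}"

lemma antichain_subset: "antichain A \<Longrightarrow> B \<subseteq> A \<Longrightarrow> antichain B"
  unfolding antichain_def by blast

lemma antichain_facets: "antichain (facets \<Delta>)"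
  unfolding antichain_def facets_def by blast

lemma facets_complex_of:
  assumes "antichain A"
  shows "facets (complex_of A) = A"
proof (intro equalityI subsetI)
  fix F assume F: "F \<in> facets (complex_of A)"
  then obtain G where G: "G \<in> A" "F \<subseteq> G"
    by (auto simp: facets_def complex_of_def)
  then have "G \<in> complex_of A"
    by (auto simp: complex_of_def)
  then have "G = F"
    using F G(2) by (simp add: facets_def)
  with G(1) show "F \<in> A" by simp
next
  fix F assume F: "F \<in> A"
  have "G = F" if G: "G \<in> complex_of A" "F \<subseteq> G" for G
  proof -
    obtain H where H: "H \<in> A" "G \<subseteq> H"
      using G(1) by (auto simp: complex_of_def)
    then have "F = H"
      using assms F G(2) unfolding antichain_def by (meson subset_trans)
    then show ?thesis
      using G(2) H(2) by simp
  qed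
  then show "F \<in> facets (complex_of A)"
    using F by (auto simp: facets_def complex_of_def)
qed

lemma is_leaf_eq: "is_leaf \<Delta> F \<longleftrightarrow> leaf_in (facets \<Delta>) F"
  by (simp add: is_leaf_def leaf_in_def)

lemma antichain_loc: "antichain (loc A F)"
  unfolding antichain_def loc_def by blast

lemma facets_localization:
  assumes "antichain A"
  shows "facets (localization (complex_of A) F) = loc A F"
proof -
  have "localization (complex_of A) F = complex_of (loc A F)"
    unfolding localization_def loc_def facets_complex_of[OF assms] Let_def Setcompr_eq_image
    by simp
  then show ?thesis
    by (simp add: facets_complex_of antichain_loc)
qed

lemma loc_subset: "loc A F \<subseteq> (\<lambda>G. G - F) ` A"
  by (auto simp: loc_def)

lemma loc_memD: "B \<in> loc A F \<Longrightarrow> \<exists>G\<in>A. B = G - F"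
  using loc_subset by blast

lemma loc_below:
  assumes "finite A" "G \<in> A"
  shows "\<exists>B\<in>loc A F. B \<subseteq> G - F"
proof -
  have "finite ((\<lambda>G. G - F) ` A)" "G - F \<in> (\<lambda>G. G - F) ` A"
    using assms by auto
  from finite_has_minimal2[OF this] show ?thesis
  proof (elim bexE conjE)
    fix B
    assume "B \<in> (\<lambda>G. G - F) ` A" "B \<subseteq> G - F" "\<forall>C\<in>(\<lambda>G. G - F) ` A. C \<subseteq> B \<longrightarrow> B = C"
    then show "\<exists>B\<in>loc A F. B \<subseteq> G - F"
      unfolding loc_def by (intro bexI[of _ B] CollectI conjI) auto
  qed
qed

text \<open>A joint \<open>G\<close> cannot contain \<open>F\<close>, and a vertex of
  \<open>F\<close> outside \<open>G\<close> lies in no other member, because all intersections with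
  \<open>F\<close> are inside \<open>G\<close>.\<close>

lemma leaf_free_vertex:
  assumes "antichain A" "leaf_in A F" "F \<noteq> {}"
  shows "\<exists>x\<in>F. \<forall>H\<in>A - {F}. x \<notin> H"
proof (cases "A = {F}")
  case True
  with assms show ?thesis by auto
next
  case False
  with assms obtain G where G: "F \<in> A" "G \<in> A" "G \<noteq> F" "\<forall>H\<in>A. H \<noteq> F \<longrightarrow> F \<inter> H \<subseteq> G"
    by (auto simp: leaf_in_def)
  then have "\<not> F \<subseteq> G"
    using assms(1) unfolding antichain_def by blast
  then show ?thesis
    using G by blast
qed

text \<open>A leaf of a system of representatives in \<open>A\<close> stays a leaf after removing \<open>F\<close> from all sets.\<close>

lemma forest_loc:
  assumes "forest A"
  shows "forest (loc A F)"
  unfolding forest_def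
proof (intro allI impI)
  fix B assume B: "B \<subseteq> loc A F" "B \<noteq> {}"
  then have "\<forall>b\<in>B. \<exists>G\<in>A. b = G - F"
    by (meson loc_memD subsetD)
  then obtain s where s: "\<And>b. b \<in> B \<Longrightarrow> s b \<in> A" "\<And>b. b \<in> B \<Longrightarrow> b = s b - F"
    by metis
  have "s ` B \<subseteq> A" "s ` B \<noteq> {}"
    using s B by auto
  then obtain L where "leaf_in (s ` B) L"
    using assms unfolding forest_def by blast
  then obtain b where b: "b \<in> B" and lf: "leaf_in (s ` B) (s b)"
    by (auto simp: leaf_in_def)
  have "leaf_in B b"
  proof (cases "s ` B = {s b}")
    case True
    have "c = b" if "c \<in> B" for c
    proof -
      have "s c = s b"
        using True that by blast
      then show ?thesis
        using s(2)[OF that] s(2)[OF b] by simp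
    qed
    then have "B = {b}"
      using b by blast
    then show ?thesis by (simp add: leaf_in_def)
  next
    case False
    with lf obtain c where c: "c \<in> B" "s c \<noteq> s b" "\<forall>H\<in>s ` B. H \<noteq> s b \<longrightarrow> s b \<inter> H \<subseteq> s c"
      by (auto simp: leaf_in_def)
    have "b \<inter> h \<subseteq> c" if "h \<in> B" "h \<noteq> b" for h
    proof -
      \<comment> \<open>The choice of representatives is injective, since \<open>b\<close> is
        recovered as \<open>s b - F\<close>; so distinct members of \<open>B\<close> have distinct
        representatives.\<close>
      have "s h \<noteq> s b"
        using that(2) s(2)[OF that(1)] s(2)[OF b] by auto
      then have "s b \<inter> s h \<subseteq> s c"
        using c(3) that by blast
      then show ?thesis
        using s(2)[OF b] s(2)[OF that(1)] s(2)[OF c(1)] by blast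
    qed
    moreover have "c \<noteq> b"
      using c(2) by blast
    ultimately show ?thesis
      using b c(1) unfolding leaf_in_def by blast
  qed
  then show "\<exists>F. leaf_in B F" by blast
qed

section \<open>Adding a facet with a free vertex\<close>

text \<open>The colon ideal by the monomial of \<open>F\<close>: a support \<open>K\<close> together
  with \<open>F\<close> contains some \<open>G\<close> exactly when \<open>K\<close> contains
  \<open>G - F\<close>, and by finiteness the minimal differences detect this.\<close>

lemma mideal_loc:
  assumes "finite A" "finite F" "F \<subseteq> V"
  shows "mideal V (loc A F) = {r \<in> polys V. monom_of F * r \<in> mideal V A}"
proof -
  have "(\<exists>B\<in>loc A F. B \<subseteq> K) \<longleftrightarrow> (\<exists>G\<in>A. G \<subseteq> F \<union> K)" for K
  proof
    assume "\<exists>B\<in>loc A F. B \<subseteq> K"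
    then obtain B where B: "B \<in> loc A F" "B \<subseteq> K" by blast
    then obtain G where "G \<in> A" "B = G - F"
      using loc_memD by metis
    with B(2) show "\<exists>G\<in>A. G \<subseteq> F \<union> K" by blast
  next
    assume "\<exists>G\<in>A. G \<subseteq> F \<union> K"
    then obtain G where G: "G \<in> A" "G \<subseteq> F \<union> K" by blast
    then obtain B where "B \<in> loc A F" "B \<subseteq> G - F"
      using loc_below[OF assms(1)] by blast
    with G show "\<exists>B\<in>loc A F. B \<subseteq> K" by blast
  qed
  then show ?thesis
    by (auto simp: mideal_def[of V "loc A F"] monom_of_mult_mideal_iff[OF assms(2,3)])
qed

text \<open>The cone with \<open>p\<close> the monomial of \<open>F - {x}\<close>. The free vertex
  \<open>x\<close> yields the inclusion p J in I, while \<open>nsub\<close> keeps the empty set out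
  of \<open>loc A F\<close>, so that \<open>J\<close> has no constant terms.\<close>

lemma minimally_resolves_insert:
  fixes T T' :: "nat \<Rightarrow> int list"
  assumes V: "finite V" and A: "finite A" and F: "F \<subseteq> V"
    and nsub: "\<And>G. G \<in> A \<Longrightarrow> \<not> G \<subseteq> F" and x: "x \<in> F" "\<And>G. G \<in> A \<Longrightarrow> x \<notin> G"
    and mI: "minimally_resolves V (mideal V A :: ('v, 'k::field) mpoly set) T E"
    and mJ: "minimally_resolves V (mideal V (loc A F) :: ('v, 'k) mpoly set) T' E'"
  shows "\<exists>E''. minimally_resolves V (mideal V (insert F A) :: ('v, 'k) mpoly set)
    (case_nat [0] (\<lambda>i. T (Suc i) @ map ((+) (int (card F))) (T' i))) E''"
proof -
  have fF: "finite F"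
    using V F finite_subset by blast
  have card: "1 + int (card (F - {x})) = int (card F)"
    using card.remove[OF fF x(1)] by simp
  have split: "monom_of F = var x * monom_of (F - {x})"
    by (rule monom_of_split[OF fF x(1)])
  have "\<exists>E''. minimally_resolves V
      {a + var x * monom_of (F - {x}) * r | a r. a \<in> (mideal V A :: ('v, 'k) mpoly set) \<and> r \<in> polys V}
      (case_nat [0] (\<lambda>i. T (Suc i) @ map ((+) (1 + int (card (F - {x})))) (T' i))) E''"
  proof (rule minimally_resolves_cone[OF mI mJ])
    show "var x \<in> homogeneous V 1"
      using monom_of_homogeneous[of "{x}" V] x(1) F by (auto simp: sqfree_exp_def var_def)
    show "monom_of (F - {x}) \<in> homogeneous V (int (card (F - {x})))"
      using fF F by (intro monom_of_homogeneous) auto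
    show "mideal V (loc A F) = {r \<in> polys V. var x * monom_of (F - {x}) * r \<in> (mideal V A :: ('v, 'k) mpoly set)}"
      using mideal_loc[OF A fF F] by (simp add: split)
  next
    fix r :: "('v, 'k) mpoly" assume r: "r \<in> mideal V (loc A F)"
    then have rV: "r \<in> polys V"
      by (simp add: mideal_def)
    \<comment> \<open>Since \<open>G\<close> avoids \<open>x\<close>, whatever of \<open>G\<close>
      lies in \<open>F\<close> already lies in \<open>F - {x}\<close>.\<close>
    have "\<exists>G\<in>A. G \<subseteq> (F - {x}) \<union> Poly_Mapping.keys m" if "m \<in> Poly_Mapping.keys r" for m
    proof -
      obtain B where "B \<in> loc A F" "B \<subseteq> Poly_Mapping.keys m"
        using r \<open>m \<in> Poly_Mapping.keys r\<close> by (auto simp: mideal_def)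
      then obtain G where "G \<in> A" "G - F \<subseteq> Poly_Mapping.keys m"
        using loc_memD by metis
      then show ?thesis using x(2) by blast
    qed
    moreover have "F - {x} \<subseteq> V" "finite (F - {x})"
      using F fF by auto
    ultimately show "monom_of (F - {x}) * r \<in> mideal V A"
      using monom_of_mult_mideal_iff[of "F - {x}" V r A] rV by blast
    have "{} \<notin> loc A F"
      using loc_memD nsub by (metis Diff_eq_empty_iff)
    then have "0 \<notin> Poly_Mapping.keys r"
      using r by (force simp: mideal_def)
    then show "const_term r = 0"
      by (simp add: const_term_def in_keys_iff)
  qed
  then show ?thesis
    unfolding card mideal_insert[OF fF F] split .
qed

section \<open>Existence of minimal resolutions and the recursion for Betti numbers\<close>

lemma minimally_resolves_zero:
  "minimally_resolves V ({0} :: ('v, 'k::field) mpoly set) (case_nat [0] (\<lambda>_. [])) (\<lambda>i. 0\<^sub>m (length (case_nat [0] (\<lambda>_. []) i)) 0)"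
proof -
  have fm: "free_module V 0 = ({vNil} :: ('v, 'k) mpoly vec set)"
    by (auto simp: free_module_def)
  have z: "(0\<^sub>m 0 0 *\<^sub>v vNil :: ('v, 'k) mpoly vec) = vNil"
    by (intro eq_vecI) auto
  show ?thesis
    unfolding minimally_resolves_def resolves_def
    by (auto simp: z gmat_def kernel_module_def image_module_def fm intro!: eq_vecI eq_matI split: nat.split)
qed

text \<open>The induction is on the number of sets: \<open>loc (A - {F}) F\<close> is in general not
  a subfamily of \<open>A\<close>, but it has at most as many members as \<open>A - {F}\<close>.
  Excluding the empty set guarantees that a leaf has a free vertex, and it is inherited because no
  other member is contained in \<open>F\<close>.\<close>

theorem forest_minimally_resolves:
  assumes "finite V" "A \<subseteq> Pow V" "antichain A" "{} \<notin> A" "forest A"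
  shows "\<exists>T E. minimally_resolves V (mideal V A :: ('v, 'k::field) mpoly set) T E"
  using assms(2-)
proof (induction "card A" arbitrary: A rule: less_induct)
  case less
  have fA: "finite A"
    using less.prems(1) assms(1) by (meson finite_Pow_iff finite_subset)
  show ?case
  proof (cases "A = {}")
    case True
    then show ?thesis
      using minimally_resolves_zero[of V] unfolding True mideal_empty by blast
  next
    case False
    then obtain F where leaf: "leaf_in A F"
      using less.prems(4) unfolding forest_def by blast
    then have F: "F \<in> A"
      by (simp add: leaf_in_def)
    obtain x where x: "x \<in> F" "\<And>G. G \<in> A - {F} \<Longrightarrow> x \<notin> G"
      using leaf_free_vertex[OF less.prems(2) leaf] F less.prems(3) by blast
    have nsub: "\<not> G \<subseteq> F" if "G \<in> A - {F}" for G
      using that less.prems(2) F unfolding antichain_def by blast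
    have lt: "card (A - {F}) < card A"
      by (rule card_Diff1_less[OF fA F])
    have forest': "forest (A - {F})"
      using less.prems(4) unfolding forest_def by blast
    obtain T E where mI: "minimally_resolves V (mideal V (A - {F}) :: ('v, 'k) mpoly set) T E"
      using less.hyps[OF lt] less.prems forest' antichain_subset[OF less.prems(2)] by blast
    have "card (loc (A - {F}) F) \<le> card ((\<lambda>G. G - F) ` (A - {F}))"
      using fA by (intro card_mono loc_subset) auto
    also have "\<dots> \<le> card (A - {F})"
      using fA by (intro card_image_le) auto
    finally have "card (loc (A - {F}) F) < card A"
      using lt by simp
    moreover have "loc (A - {F}) F \<subseteq> Pow V"
      using less.prems(1) by (auto dest!: loc_memD)
    moreover have "{} \<notin> loc (A - {F}) F"
      using loc_memD nsub by (metis Diff_eq_empty_iff)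
    ultimately obtain T' E' where "minimally_resolves V (mideal V (loc (A - {F}) F) :: ('v, 'k) mpoly set) T' E'"
      using less.hyps antichain_loc forest_loc[OF forest'] by blast
    from minimally_resolves_insert[OF assms(1) _ _ nsub x mI this]
    show ?thesis
      using fA F less.prems(1) by (auto simp: insert_absorb)
  qed
qed

text \<open>In augmented indexing, degree \<open>Suc i\<close> is read off the cone at
  \<open>Suc (Suc i)\<close>, where the second summand is the shifted \<open>T' (Suc i)\<close>,
  that is, degree \<open>i\<close> for the localization. One degree lower the second summand would
  be \<open>T' 0 = [0]\<close>, the new generator itself.\<close>

theorem graded_betti_insert:
  assumes V: "finite V" and sub: "insert F A \<subseteq> Pow V" and ac: "antichain (insert F A)"
    and ne: "{} \<notin> insert F A" and forest: "forest A" and leaf: "leaf_in (insert F A) F" and F: "F \<notin> A"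
  shows "graded_betti V (mideal V (insert F A) :: ('v, 'k::field) mpoly set) (Suc i) j =
    graded_betti V (mideal V A :: ('v, 'k) mpoly set) (Suc i) j +
    graded_betti V (mideal V (loc A F) :: ('v, 'k) mpoly set) i (j - int (card F))"
proof -
  have fA: "finite A"
    using sub V by (meson finite_Pow_iff finite_insert finite_subset)
  have acA: "antichain A"
    using ac by (rule antichain_subset) blast
  obtain x where x: "x \<in> F" "\<And>G. G \<in> A \<Longrightarrow> x \<notin> G"
    using leaf_free_vertex[OF ac leaf] F ne by blast
  have nsub: "\<not> G \<subseteq> F" if "G \<in> A" for G
    using that ac F unfolding antichain_def by blast
  obtain T E where mI: "minimally_resolves V (mideal V A :: ('v, 'k) mpoly set) T E"
    using forest_minimally_resolves[OF V _ acA _ forest] sub ne by blast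
  have "loc A F \<subseteq> Pow V"
    using sub by (auto dest!: loc_memD)
  moreover have "{} \<notin> loc A F"
    using loc_memD nsub by (metis Diff_eq_empty_iff)
  ultimately obtain T' E' where mJ: "minimally_resolves V (mideal V (loc A F) :: ('v, 'k) mpoly set) T' E'"
    using forest_minimally_resolves[OF V _ antichain_loc _ forest_loc[OF forest]] by blast
  obtain E'' where mK: "minimally_resolves V (mideal V (insert F A) :: ('v, 'k) mpoly set)
      (case_nat [0] (\<lambda>i. T (Suc i) @ map ((+) (int (card F))) (T' i))) E''"
    using minimally_resolves_insert[OF V fA _ nsub x mI mJ] sub by blast
  have "count_list (map ((+) d) xs) j = count_list xs (j - d)" for d :: int and xs
    by (induction xs) auto
  then show ?thesis
    by (simp add: graded_betti_eq_count[OF mI] graded_betti_eq_count[OF mJ] graded_betti_eq_count[OF mK])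
qed

text \<open>Every set of facets is an antichain, hence is the full set of facets of the
  subcollection it spans, and the leaf of that subcollection is the leaf sought.\<close>

lemma simplicial_forest_facets:
  assumes "simplicial_forest V \<Delta>"
  shows "forest (facets \<Delta>)"
  unfolding forest_def
proof (intro allI impI)
  fix B assume B: "B \<subseteq> facets \<Delta>" "B \<noteq> {}"
  have V: "finite V" "\<And>F. F \<in> facets \<Delta> \<Longrightarrow> F \<subseteq> V"
    and all: "\<And>\<Gamma>. subcollection \<Gamma> \<Delta> \<Longrightarrow> \<Gamma> \<noteq> {} \<Longrightarrow> \<exists>F. is_leaf \<Gamma> F"
    using assms by (auto simp: simplicial_forest_def simplicial_complex_on_def facets_def)
  have fac: "facets (complex_of B) = B"
    using antichain_subset[OF antichain_facets B(1)] by (rule facets_complex_of)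
  have "finite (\<Union>(complex_of B))"
    using V B(1) by (intro finite_subset[OF _ V(1)]) (auto simp: complex_of_def)
  then have "subcollection (complex_of B) \<Delta>"
    unfolding subcollection_def simplicial_complex_on_def fac
    using B(1) by (auto simp: complex_of_def)
  moreover have "complex_of B \<noteq> {}"
    using B(2) by (auto simp: complex_of_def)
  ultimately show "\<exists>F. leaf_in B F"
    using all[of "complex_of B"] by (simp add: is_leaf_eq fac)
qed

theorem proposition4p9:
  fixes V :: "'v set" and \<Delta> :: "'v set set" and F :: "nat \<Rightarrow> 'v set"
    and q i :: nat and j :: int
  assumes "simplicial_tree V \<Delta>"
    and "good_leaf_order \<Delta> q F"
    and "\<forall>u\<le>q. is_leaf (complex_of (F ` {..u})) (F u)"
    and "i \<ge> 1" and "j \<ge> 0"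
  shows "graded_betti V (facet_ideal V \<Delta> :: ('v, 'k::field) mpoly set) i j =
    graded_betti V (facet_ideal V (complex_of {F 0}) :: ('v, 'k) mpoly set) i j +
    (\<Sum>u=1..q. graded_betti V
       (facet_ideal V (localization (complex_of (F ` {..u - 1})) (F u)) :: ('v, 'k) mpoly set)
       (i - 1) (j - int (card (F u))))"
proof -
  have V: "finite V" and FV: "\<And>G. G \<in> facets \<Delta> \<Longrightarrow> G \<subseteq> V"
    using assms(1) by (auto simp: simplicial_tree_def simplicial_forest_def
        simplicial_complex_on_def facets_def)
  have bij: "bij_betw F {..q} (facets \<Delta>)"
    using assms(2) by (simp add: good_leaf_order_def)
  then have img: "F ` {..q} = facets \<Delta>" and inj: "inj_on F {..q}"
    by (auto simp: bij_betw_def)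
  have forest: "forest (facets \<Delta>)"
    using assms(1) simplicial_forest_facets by (auto simp: simplicial_tree_def)
  have sub: "F ` {..u} \<subseteq> facets \<Delta>" if "u \<le> q" for u
    using img that by auto
  have ac: "antichain (F ` {..u})" if "u \<le> q" for u
    using sub[OF that] by (rule antichain_subset[OF antichain_facets])
  have fac: "facets (complex_of (F ` {..u})) = F ` {..u}" if "u \<le> q" for u
    using ac[OF that] by (rule facets_complex_of)
  have ideal: "facet_ideal V (complex_of (F ` {..u})) = (mideal V (F ` {..u}) :: ('v, 'k) mpoly set)"
    if "u \<le> q" for u
  proof -
    have "G \<subseteq> V" if "G \<in> facets (complex_of (F ` {..u}))" for G
      using that sub[OF \<open>u \<le> q\<close>] FV unfolding fac[OF \<open>u \<le> q\<close>] by blast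
    then have "facet_ideal V (complex_of (F ` {..u})) =
        (mideal V (facets (complex_of (F ` {..u}))) :: ('v, 'k) mpoly set)"
      by (rule facet_ideal_eq_mideal[OF V])
    then show ?thesis
      unfolding fac[OF that] .
  qed
  let ?B = "\<lambda>u. graded_betti V (facet_ideal V (complex_of (F ` {..u})) :: ('v, 'k) mpoly set) i j"
  let ?L = "\<lambda>u. graded_betti V
       (facet_ideal V (localization (complex_of (F ` {..u - 1})) (F u)) :: ('v, 'k) mpoly set)
       (i - 1) (j - int (card (F u)))"
  obtain i' where i': "i = Suc i'"
    using assms(4) by (cases i) auto
  have step: "?B (Suc u) = ?B u + ?L (Suc u)" if u: "Suc u \<le> q" for u
  proof -
    have ins: "F ` {..Suc u} = insert (F (Suc u)) (F ` {..u})"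
      by (simp add: atMost_Suc)
    have notin: "F (Suc u) \<notin> F ` {..u}"
      using inj_onD[OF inj, of "Suc u"] u by fastforce
    \<comment> \<open>An empty facet would be contained in all others and hence, in an antichain,
      equal to them; but \<open>F (Suc u)\<close> and \<open>F 0\<close> are distinct.\<close>
    have ne: "{} \<notin> insert (F (Suc u)) (F ` {..u})"
    proof
      assume e: "{} \<in> insert (F (Suc u)) (F ` {..u})"
      have "G = {}" if "G \<in> insert (F (Suc u)) (F ` {..u})" for G
        using ac[OF u] e that unfolding ins antichain_def by blast
      then have "F (Suc u) = {}" "F 0 = {}" by auto
      then show False using notin by force
    qed
    have locV: "facets (localization (complex_of (F ` {..u})) (F (Suc u))) = loc (F ` {..u}) (F (Suc u))"
      using ac[of u] u by (intro facets_localization) simp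
    have "G \<subseteq> V" if "G \<in> loc (F ` {..u}) (F (Suc u))" for G
      using loc_memD[OF that] sub[of u] u FV by fastforce
    then have "facet_ideal V (localization (complex_of (F ` {..u})) (F (Suc u))) =
        (mideal V (facets (localization (complex_of (F ` {..u})) (F (Suc u)))) :: ('v, 'k) mpoly set)"
      unfolding locV[symmetric] by (rule facet_ideal_eq_mideal[OF V])
    note locideal = this[unfolded locV]
    have "?B (Suc u) = graded_betti V (mideal V (insert (F (Suc u)) (F ` {..u})) :: ('v, 'k) mpoly set) (Suc i') j"
      using ideal[OF u] by (simp add: ins i')
    also have "\<dots> = graded_betti V (mideal V (F ` {..u}) :: ('v, 'k) mpoly set) (Suc i') j +
        graded_betti V (mideal V (loc (F ` {..u}) (F (Suc u))) :: ('v, 'k) mpoly set) i' (j - int (card (F (Suc u))))"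
    proof (rule graded_betti_insert[OF V _ _ ne _ _ notin])
      show "insert (F (Suc u)) (F ` {..u}) \<subseteq> Pow V"
        using sub[OF u] FV unfolding ins by blast
      show "antichain (insert (F (Suc u)) (F ` {..u}))"
        using ac[OF u] unfolding ins .
      show "forest (F ` {..u})"
        using forest sub[of u] u unfolding forest_def by (meson Suc_leD subset_trans)
      show "leaf_in (insert (F (Suc u)) (F ` {..u})) (F (Suc u))"
        using assms(3) u fac[OF u] by (metis ins is_leaf_eq)
    qed
    also have "\<dots> = ?B u + ?L (Suc u)"
      using ideal[of u] u by (simp add: locideal i')
    finally show ?thesis .
  qed
  \<comment> \<open>The steps telescope, and \<open>?B 0\<close> is the term of the single facet
    because the image of \<open>{..0}\<close> is \<open>{F 0}\<close>.\<close>
  have "?B u = ?B 0 + (\<Sum>v=1..u. ?L v)" if "u \<le> q" for u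
    using that
  proof (induction u)
    case (Suc u)
    then show ?case
      using step[of u] by simp
  qed simp
  \<comment> \<open>A facet ideal depends on the complex only through its facets, so it is enough
    that both sides have the same ones.\<close>
  moreover have "facet_ideal V \<Delta> = (facet_ideal V (complex_of (F ` {..q})) :: ('v, 'k) mpoly set)"
    unfolding facet_ideal_def using fac[of q] img by simp
  ultimately show ?thesis
    by simp
qed

end
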